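(* For each even integer $w\geqslant 4$ there is a partial Steiner triple system whose leave $L$ (a graph on $u$ vertices, say) satisfies all of the following conditions, and yet the graph $L\vee K_w$ has no $K_3$-decomposition: (1) $\deg_L(x)\equiv w \pmod 2$ for each vertex $x$ of $L$; (2) $u+w$ is odd if $w>0$; (3) $|E(L)|+uw+\binom{w}{2}\equiv 0\pmod 3$; (4) there is a subgraph $G$ of $L$ such that (i) $L-G$ has a $K_3$-decomposition, (ii) $w^2-(u+1)w+2|E(G)|\geqslant 0$, and (iii) $G$ is $w$-edge colourable.
   Context: A partial Steiner triple system $(U,\mathcal{A})$ consists of a finite set $U$ and a set $\mathcal{A}$ of 3-element subsets of $U$ such that any two elements of $U$ lie together in at most one triple. Its leave is the graph with vertex set $U$ whose edges are the pairs $xy$ not contained in any triple of $\mathcal{A}$. A $K_3$-decomposition of a graph is a set of triangles in it such that each edge lies in exactly one of them. For vertex-disjoint graphs $G,H$, $G\vee H$ is the graph on $V(G)\cup V(H)$ with edge set $E(G)\cup E(H)\cup\{xy: x\in V(G), y\in V(H)\}$; $K_w$ is the complete graph on $w$ new vertices. For graphs $G\subseteq L$, $L-G$ has vertex set $V(L)$ and edge set $E(L)\setminus E(G)$. Edge colourings are proper. *)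

theory Defs
  imports Main
begin

text \<open>Graphs are given by a vertex set V and an edge set E of 2-element subsets of V.\<close>

definition partial_sts :: "'a set \<Rightarrow> 'a set set \<Rightarrow> bool" where
  "partial_sts U A \<longleftrightarrow> finite U \<and> (\<forall>T\<in>A. T \<subseteq> U \<and> card T = 3) \<and>
     (\<forall>x\<in>U. \<forall>y\<in>U. x \<noteq> y \<longrightarrow> card {T\<in>A. {x, y} \<subseteq> T} \<le> 1)"

definition leave :: "'a set \<Rightarrow> 'a set set \<Rightarrow> 'a set set" where
  "leave U A = {{x, y} | x y. x \<in> U \<and> y \<in> U \<and> x \<noteq> y \<and> \<not> (\<exists>T\<in>A. {x, y} \<subseteq> T)}"

definition degree :: "'a set set \<Rightarrow> 'a \<Rightarrow> nat" where
  "degree E x = card {e\<in>E. x \<in> e}"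

definition K3_decomposition :: "'a set set \<Rightarrow> 'a set set \<Rightarrow> bool" where
  "K3_decomposition E \<T> \<longleftrightarrow>
     (\<forall>T\<in>\<T>. card T = 3 \<and> {e. e \<subseteq> T \<and> card e = 2} \<subseteq> E) \<and>
     (\<forall>e\<in>E. \<exists>!T. T \<in> \<T> \<and> e \<subseteq> T)"

definition has_K3_decomposition :: "'a set set \<Rightarrow> bool" where
  "has_K3_decomposition E \<longleftrightarrow> (\<exists>\<T>. K3_decomposition E \<T>)"

text \<open>Edge set of L \<or> K_W, where L has vertex set U and edge set E, and W is disjoint from U.\<close>
definition join_complete :: "'a set \<Rightarrow> 'a set set \<Rightarrow> 'a set \<Rightarrow> 'a set set" where
  "join_complete U E W = E \<union> {{x, y} | x y. x \<in> W \<and> y \<in> W \<and> x \<noteq> y}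
      \<union> {{x, y} | x y. x \<in> U \<and> y \<in> W}"

definition edge_colourable :: "'a set set \<Rightarrow> nat \<Rightarrow> bool" where
  "edge_colourable E k \<longleftrightarrow> (\<exists>c :: 'a set \<Rightarrow> nat. (\<forall>e\<in>E. c e < k) \<and>
     (\<forall>e\<in>E. \<forall>f\<in>E. e \<noteq> f \<and> e \<inter> f \<noteq> {} \<longrightarrow> c e \<noteq> c f))"

end

theory Submission
  imports Defs "HOL-Number_Theory.Cong"
begin

text \<open>Suppose that the leave has a union \<open>C\<close> of components with an even number of vertices which is
  triangle-free and in which all degrees are \<open>w\<close>, except that two vertices \<open>x\<close> and \<open>y\<close> have degree
  \<open>w - 2\<close>. In a decomposition of the join with \<open>K\<^sub>w\<close> every edge of \<open>C\<close> lies in a triangle with a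
  vertex of \<open>K\<^sub>w\<close>, that is, the edges of \<open>C\<close> are properly coloured by the vertices of \<open>K\<^sub>w\<close>. Each
  colour misses an even number of vertices of \<open>C\<close>, so \<open>x\<close> and \<open>y\<close> miss the same two colours \<open>z, t\<close>.
  Then \<open>{x, z, t}\<close> and \<open>{y, z, t}\<close> are both triangles of the decomposition and share the edge
  \<open>{z, t}\<close>, a contradiction.

  Such a leave arises from a Latin square on parts X, Y, Z of sizes \<open>m, m, m - w\<close>, in which \<open>w\<close>
  perfect matchings between X and Y stay uncovered, and from Steiner triple systems on X and Y, by
  exchanging five triples for seven others. The part Z then contributes a complete graph minus a
  4-cycle, and the subgraph \<open>G\<close> is the whole leave.\<close>

section \<open>The parity obstruction\<close>

lemma no_K3_decomposition_join:
  fixes U C W :: "'a set"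
  assumes E: "\<And>e. e \<in> E \<Longrightarrow> e \<subseteq> U \<and> card e = 2"
    and fU: "finite U" and CU: "C \<subseteq> U" and evC: "even (card C)"
    and closed: "\<And>e. e \<in> E \<Longrightarrow> e \<inter> C \<noteq> {} \<Longrightarrow> e \<subseteq> C"
    and tri: "\<And>a b c. a \<in> C \<Longrightarrow> {a, b} \<in> E \<Longrightarrow> {a, c} \<in> E \<Longrightarrow> {b, c} \<notin> E"
    and xy: "x \<in> C" "y \<in> C" "x \<noteq> y"
    and degx: "degree E x + 2 = w" and degy: "degree E y + 2 = w"
    and deg: "\<And>v. v \<in> C \<Longrightarrow> v \<noteq> x \<Longrightarrow> v \<noteq> y \<Longrightarrow> degree E v = w"
    and W: "finite W" "card W = w" "W \<inter> U = {}"
  shows "\<not> has_K3_decomposition (join_complete U E W)"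
proof
  let ?J = "join_complete U E W"
  assume "has_K3_decomposition ?J"
  then obtain \<T> where dec: "K3_decomposition ?J \<T>"
    by (auto simp: has_K3_decomposition_def)
  have T3: "card T = 3" and TJ: "\<And>e. e \<subseteq> T \<Longrightarrow> card e = 2 \<Longrightarrow> e \<in> ?J" if "T \<in> \<T>" for T
    using dec that by (auto simp: K3_decomposition_def)
  have ex1: "\<exists>!T. T \<in> \<T> \<and> e \<subseteq> T" if "e \<in> ?J" for e
    using dec that by (auto simp: K3_decomposition_def)
  have UW: "v \<in> U \<Longrightarrow> v \<notin> W" for v using W(3) by auto
  have fC: "finite C" using fU CU finite_subset by blast
  have CW: "v \<in> C \<Longrightarrow> v \<notin> W" for v using UW CU by auto
  have third: "\<exists>t. t \<notin> e \<and> insert t e \<in> \<T>" if e: "e \<in> ?J" "card e = 2" for e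
  proof -
    obtain T where T: "T \<in> \<T>" "e \<subseteq> T" using ex1[OF e(1)] by auto
    have fin: "finite e" using e(2) card.infinite by fastforce
    have "card (T - e) = 1" using T3[OF T(1)] T(2) e(2) fin by (simp add: card_Diff_subset)
    then obtain t where "T - e = {t}" by (auto simp: card_1_singleton_iff)
    then have "t \<notin> e" "insert t e = T" using T(2) by auto
    then show ?thesis using T(1) by blast
  qed
  \<comment> \<open>The triple through an edge is unique, so its third point is too. Every later
    identification of points rests on this.\<close>
  have uniq: "t = t'" if "e \<in> ?J" "insert t e \<in> \<T>" "insert t' e \<in> \<T>" "t \<notin> e" for e t t'
  proof -
    have "insert t e = insert t' e" using ex1[OF that(1)] that(2,3) by blast
    then show ?thesis using that(4) by auto
  qed
  have JC: "b \<in> W \<or> {a, b} \<in> E" if "{a, b} \<in> ?J" "a \<in> C" for a b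
    using that CW[of a] CU UW by (auto simp: join_complete_def doubleton_eq_iff)
  have JCW: "{v, z} \<in> ?J" if "v \<in> C" "z \<in> W" for v z
    using that CU by (auto simp: join_complete_def)
  have JE: "e \<in> E \<Longrightarrow> e \<in> ?J" for e by (simp add: join_complete_def)
  have ec2: "\<exists>t. t \<noteq> v \<and> e = {v, t}" if "e \<in> E" "v \<in> e" for e v
  proof -
    have "card e = 2" using E that by auto
    then obtain p q where "e = {p, q}" "p \<noteq> q" by (auto simp: card_2_iff)
    then show ?thesis using that(2) by auto
  qed
  \<comment> \<open>Reading \<open>W\<close> as the set of colours, \<open>P v\<close> holds the
    colours of the edges of \<open>E\<close> at \<open>v\<close>, and \<open>N v\<close> the colours
    missing at \<open>v\<close>. A missing colour \<open>z\<close> is one whose edge to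
    \<open>v\<close> has its triple closed by a second vertex of \<open>W\<close>.\<close>
  define N where "N v = {z \<in> W. \<exists>t\<in>W. t \<noteq> z \<and> {v, z, t} \<in> \<T>}" for v
  define P where "P v = {z \<in> W. \<exists>e\<in>E. v \<in> e \<and> insert z e \<in> \<T>}" for v
  have split: "z \<in> N v \<longleftrightarrow> z \<notin> P v" if v: "v \<in> C" and z: "z \<in> W" for v z
  proof -
    have vz: "v \<noteq> z" using CW v z by auto
    obtain t where t: "t \<notin> {v, z}" "{t, v, z} \<in> \<T>"
      using third[OF JCW[OF v z]] vz by auto
    have "{v, t} \<in> ?J" by (rule TJ[OF t(2)]) (use t in auto)
    then have "t \<in> W \<or> {v, t} \<in> E" using JC v by blast
    moreover have "{v, z, t} = {t, v, z}" "insert z {v, t} = {t, v, z}" by auto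
    ultimately have 1: "z \<in> N v \<or> z \<in> P v"
      unfolding N_def P_def using t z by (metis (mono_tags, lifting) insertI1 insertI2 mem_Collect_eq)
    have 2: False if zN: "z \<in> N v" and zP: "z \<in> P v"
    proof -
      obtain s where s: "s \<in> W" "s \<noteq> z" "{v, z, s} \<in> \<T>" using zN by (auto simp: N_def)
      obtain e where e: "e \<in> E" "v \<in> e" "insert z e \<in> \<T>" using zP by (auto simp: P_def)
      obtain r where r: "r \<noteq> v" "e = {v, r}" using ec2 e by blast
      have "r \<notin> W" using E[OF e(1)] r UW by auto
      moreover have "insert s {v, z} \<in> \<T>" "insert r {v, z} \<in> \<T>"
        using s e r by (auto simp: insert_commute)
      then have "s = r" using uniq[OF JCW[OF v z], of s r] s(1,2) CW[OF v] by auto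
      ultimately show False using s by auto
    qed
    show ?thesis using 1 2 by blast
  qed
  have cardP: "card (P v) = degree E v" if v: "v \<in> C" for v
  proof -
    define g where "g e = (SOME z. z \<in> W \<and> insert z e \<in> \<T>)" for e
    have g: "g e \<in> W \<and> insert (g e) e \<in> \<T>" if e: "e \<in> E" "v \<in> e" for e
    proof -
      obtain t where t: "t \<notin> e" "insert t e \<in> \<T>" using third[OF JE] e E by blast
      obtain r where r: "r \<noteq> v" "e = {v, r}" using ec2 e by blast
      have rC: "r \<in> C" using closed[OF e(1)] v r by auto
      have 1: "{v, t} \<in> ?J" by (rule TJ[OF t(2)]) (use t r in auto)
      have 2: "{r, t} \<in> ?J" by (rule TJ[OF t(2)]) (use t r in auto)
      \<comment> \<open>If \<open>t\<close> were not in \<open>W\<close>, then \<open>v\<close>,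
        \<open>r\<close>, \<open>t\<close> would span a triangle of \<open>E\<close> inside
        \<open>C\<close>.\<close>
      have "t \<in> W"
        using JC[OF 1 v] JC[OF 2 rC] tri[OF v, of r t] e r by auto
      then show ?thesis unfolding g_def using t(2) by (metis (mono_tags, lifting) someI_ex)
    qed
    \<comment> \<open>\<open>g e\<close> is the colour of \<open>e\<close>. Two edges at
      \<open>v\<close> of the same colour would give two third points for the pair
      \<open>{v, g e}\<close>.\<close>
    have "bij_betw g {e \<in> E. v \<in> e} (P v)"
    proof (rule bij_betwI')
      fix e f assume e: "e \<in> {e \<in> E. v \<in> e}" and f: "f \<in> {e \<in> E. v \<in> e}"
      show "(g e = g f) = (e = f)"
      proof
        assume eq: "g e = g f"
        obtain r where r: "r \<noteq> v" "e = {v, r}" using ec2 e by blast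
        obtain s where s: "s \<noteq> v" "f = {v, s}" using ec2 f by blast
        have ge: "g e \<in> W" "insert (g e) e \<in> \<T>" "insert (g e) f \<in> \<T>"
          using g[of e] g[of f] e f eq by auto
        have rU: "r \<notin> W" using E[of e] e r UW by auto
        have "insert r {v, g e} \<in> \<T>" "insert s {v, g e} \<in> \<T>"
          using ge r s by (auto simp: insert_commute)
        then have "r = s" using uniq[OF JCW[OF v ge(1)], of r s] r(1) rU ge(1) by auto
        then show "e = f" using r s by simp
      qed simp
    next
      fix e assume "e \<in> {e \<in> E. v \<in> e}"
      then show "g e \<in> P v" using g[of e] by (auto simp: P_def)
    next
      fix z assume "z \<in> P v"
      then obtain e where e: "e \<in> E" "v \<in> e" "insert z e \<in> \<T>" "z \<in> W" by (auto simp: P_def)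
      then have "z \<notin> e" using E UW by blast
      then have "z = g e" using uniq[OF JE[OF e(1)] e(3)] g[OF e(1,2)] by auto
      then show "\<exists>e\<in>{e \<in> E. v \<in> e}. z = g e" using e by auto
    qed
    then show ?thesis by (simp add: bij_betw_same_card degree_def)
  qed
  have cardN: "card (N v) + degree E v = w" if v: "v \<in> C" for v
  proof -
    have "W = N v \<union> P v" "N v \<inter> P v = {}" using split[OF v] by (auto simp: N_def P_def)
    then show ?thesis using W cardP[OF v] card_Un_disjoint[of "N v" "P v"] finite_Un by metis
  qed
  have par: "even (card {v \<in> C. z \<in> N v})" if z: "z \<in> W" for z
  proof -
    \<comment> \<open>\<open>M\<close> is the colour class of \<open>z\<close> within
      \<open>C\<close>. It is a matching, so it meets an even number of vertices and leaves an even
      number of the even set \<open>C\<close>.\<close>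
    define M where "M = {e \<in> E. e \<subseteq> C \<and> insert z e \<in> \<T>}"
    have fM: "finite M" using fC by (auto simp: M_def intro: finite_subset[of _ "Pow C"])
    have un: "{v \<in> C. z \<in> P v} = \<Union>M"
      using z closed by (auto simp: P_def M_def)
    have dis: "e \<inter> f = {}" if ef: "e \<in> M" "f \<in> M" "e \<noteq> f" for e f
    proof (rule ccontr)
      assume "e \<inter> f \<noteq> {}"
      then obtain v where v: "v \<in> e" "v \<in> f" by auto
      have vC: "v \<in> C" using v ef by (auto simp: M_def)
      then have vz: "z \<notin> e" "z \<notin> f" using ef CW z by (auto simp: M_def)
      have "insert z e = insert z f"
        using ex1[OF JCW[OF vC z]] v ef(1,2) by (auto simp: M_def)
      then show False using vz ef(3) by (metis insert_ident)
    qed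
    have "card (\<Union>M) = sum card M"
      by (rule card_Union_disjoint)
        (use dis fC in \<open>auto simp: pairwise_def disjnt_def M_def intro: finite_subset\<close>)
    also have "\<dots> = (\<Sum>e\<in>M. 2)" by (rule sum.cong) (use E in \<open>auto simp: M_def\<close>)
    finally have "even (card {v \<in> C. z \<in> P v})" using un by simp
    moreover have "C = {v \<in> C. z \<in> P v} \<union> {v \<in> C. z \<in> N v}" using split z by auto
    then have "card C = card {v \<in> C. z \<in> P v} + card {v \<in> C. z \<in> N v}"
      using card_Un_disjoint[of "{v \<in> C. z \<in> P v}" "{v \<in> C. z \<in> N v}"] fC split z by auto
    ultimately show ?thesis using evC by simp
  qed
  have only: "{v \<in> C. z \<in> N v} \<subseteq> {x, y}" for z
  proof
    fix v assume v: "v \<in> {v \<in> C. z \<in> N v}"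
    have "finite (N v)" using W by (simp add: N_def)
    then have "card (N v) \<noteq> 0" using v by auto
    then show "v \<in> {x, y}" using cardN[of v] deg[of v] v by auto
  qed
  have Ny: "z \<in> N y" if z: "z \<in> N x" for z
  proof (rule ccontr)
    assume "z \<notin> N y"
    then have "{v \<in> C. z \<in> N v} = {x}" using only[of z] z xy by auto
    moreover have "z \<in> W" using z by (simp add: N_def)
    ultimately show False using par[of z] by simp
  qed
  have N2: "card (N x) = 2" "card (N y) = 2" using cardN[OF xy(1)] cardN[OF xy(2)] degx degy by auto
  have Nsym: "\<exists>t\<in>N v. t \<noteq> z \<and> {v, z, t} \<in> \<T>" if zN: "z \<in> N v" for v z
  proof -
    obtain t where "t \<in> W" "t \<noteq> z" "{v, z, t} \<in> \<T>" "z \<in> W" using zN by (auto simp: N_def)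
    moreover have "{v, t, z} = {v, z, t}" by auto
    ultimately show ?thesis unfolding N_def by (intro bexI[of _ t]) auto
  qed
  obtain z where z: "z \<in> N x" using N2(1) by fastforce
  obtain t where t: "t \<in> N x" "t \<noteq> z" "{x, z, t} \<in> \<T>" using Nsym[OF z] by auto
  obtain s where s: "s \<in> N y" "s \<noteq> z" "{y, z, s} \<in> \<T>" using Nsym[OF Ny[OF z]] by auto
  \<comment> \<open>\<open>N y\<close> has only two elements but contains \<open>s\<close> and
    \<open>z\<close>, and also \<open>t\<close> because every colour missing at \<open>x\<close> is
    missing at \<open>y\<close>.\<close>
  have "s = t"
  proof (rule ccontr)
    assume "s \<noteq> t"
    then have "card {s, t, z} = 3" using s t by auto
    moreover have "{s, t, z} \<subseteq> N y" using s Ny z t by auto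
    moreover have "finite (N y)" using W by (simp add: N_def)
    ultimately show False using N2(2) card_mono[of "N y" "{s, t, z}"] by simp
  qed
  moreover have "{z, t} \<in> ?J"
    using z t by (auto simp: join_complete_def N_def)
  moreover have "x \<notin> {z, t}" using z t CW xy by (auto simp: N_def)
  ultimately show False using uniq[of "{z, t}" x y] t s xy(3) by simp
qed

section \<open>Steiner triple systems\<close>

definition steiner_triple_system :: "'a set \<Rightarrow> 'a set set \<Rightarrow> bool" where
  "steiner_triple_system V S \<longleftrightarrow> (\<forall>T\<in>S. T \<subseteq> V \<and> card T = 3) \<and>
     (\<forall>x\<in>V. \<forall>y\<in>V. x \<noteq> y \<longrightarrow> (\<exists>!T. T \<in> S \<and> {x, y} \<subseteq> T))"

text \<open>Here \<open>f\<close> is the third-point operation of a Steiner quasigroup off the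
  diagonal. Its laws let any two points of \<open>{x, y, f x y}\<close> regenerate the third, so a
  block is determined by each of its pairs.\<close>

lemma steiner_triple_system_of_third_point:
  assumes V: "\<And>x y. x \<in> V \<Longrightarrow> y \<in> V \<Longrightarrow> x \<noteq> y \<Longrightarrow> f x y \<in> V \<and> f x y \<noteq> x"
    and comm: "\<And>x y. x \<in> V \<Longrightarrow> y \<in> V \<Longrightarrow> x \<noteq> y \<Longrightarrow> f x y = f y x"
    and inv: "\<And>x y. x \<in> V \<Longrightarrow> y \<in> V \<Longrightarrow> x \<noteq> y \<Longrightarrow> f x (f x y) = y"
  shows "steiner_triple_system V {{x, y, f x y} | x y. x \<in> V \<and> y \<in> V \<and> x \<noteq> y}"
proof -
  have ne: "f x y \<noteq> x" "f x y \<noteq> y" "f x y \<in> V" if "x \<in> V" "y \<in> V" "x \<noteq> y" for x y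
    using V[OF that] V[of y x] comm[OF that] that by auto
  have third: "{x, y, f x y} = {a, b, f a b}"
    if xy: "x \<in> V" "y \<in> V" "x \<noteq> y" and ab: "{a, b} \<subseteq> {x, y, f x y}" "a \<noteq> b" for x y a b
  proof -
    note n = ne[OF xy]
    have 1: "f x (f x y) = y" "f (f x y) x = y" "f y x = f x y"
      using inv[OF xy] comm[OF xy] comm[of x "f x y"] n xy by auto
    have 2: "f y (f x y) = x" "f (f x y) y = x"
      using inv[of y x] comm[OF xy] comm[of y "f x y"] n xy by auto
    show ?thesis using ab n xy 1 2 by auto
  qed
  show ?thesis unfolding steiner_triple_system_def
  proof (intro conjI ballI impI)
    fix T assume "T \<in> {{x, y, f x y} | x y. x \<in> V \<and> y \<in> V \<and> x \<noteq> y}"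
    then obtain x y where T: "T = {x, y, f x y}" "x \<in> V" "y \<in> V" "x \<noteq> y" by blast
    then show "T \<subseteq> V" "card T = 3" using ne[of x y] by auto
  next
    fix a b assume ab: "a \<in> V" "b \<in> V" "a \<noteq> b"
    show "\<exists>!T. T \<in> {{x, y, f x y} | x y. x \<in> V \<and> y \<in> V \<and> x \<noteq> y} \<and> {a, b} \<subseteq> T"
    proof (rule ex1I[of _ "{a, b, f a b}"])
      show "{a, b, f a b} \<in> {{x, y, f x y} | x y. x \<in> V \<and> y \<in> V \<and> x \<noteq> y} \<and> {a, b} \<subseteq> {a, b, f a b}"
        using ab by blast
    next
      fix T assume "T \<in> {{x, y, f x y} | x y. x \<in> V \<and> y \<in> V \<and> x \<noteq> y} \<and> {a, b} \<subseteq> T"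
      then obtain x y where "T = {x, y, f x y}" "x \<in> V" "y \<in> V" "x \<noteq> y" "{a, b} \<subseteq> T" by blast
      then show "T = {a, b, f a b}" using third[of x y a b] ab(3) by simp
    qed
  qed
qed

text \<open>Bose's construction on the points \<open>(i, k) \<in> \<int>/n \<times> \<int>/3\<close>, encoded as \<open>3 * i + k\<close>;
  \<open>(n + 1) div 2\<close> is the inverse of 2 modulo \<open>n\<close>.\<close>

definition bose :: "nat \<Rightarrow> nat \<Rightarrow> nat \<Rightarrow> nat" where
  "bose n x y =
    (let i = x div 3; k = x mod 3; j = y div 3; l = y mod 3 in
     if i = j then 3 * i + (3 - k - l)
     else if k = l then 3 * ((i + j) * ((n + 1) div 2) mod n) + Suc k mod 3
     else if l = Suc k mod 3 then 3 * ((2 * j + (n - i)) mod n) + k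
     else 3 * ((2 * i + (n - j)) mod n) + l)"

text \<open>With halving modulo the odd number \<open>n\<close> and \<open>n - i\<close> standing
  for \<open>-i\<close>, these are the inversions that Bose's construction needs: a midpoint undone
  by a reflection, a reflection undone by a midpoint, and a reflection in \<open>i\<close> undone by
  itself.\<close>

lemma half_sum_mod:
  fixes n i j :: nat
  assumes "odd n" "i < n" "j < n"
  shows "(2 * ((i + j) * ((n + 1) div 2) mod n) + (n - i)) mod n = j"
    and "(i + (2 * j + (n - i)) mod n) * ((n + 1) div 2) mod n = j"
    and "(2 * i + (n - (2 * i + (n - j)) mod n)) mod n = j"
proof -
  obtain h where h: "(n + 1) div 2 = h" "2 * h = n + 1" using assms(1) by (metis dvd_mult_div_cancel even_plus_one_iff)
  have 1: "[2 * ((i + j) * h mod n) + (n - i) = 2 * ((i + j) * h) + (n - i)] (mod n)"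
    by (intro cong_add cong_mult) (auto simp: cong_def)
  have 2: "2 * ((i + j) * h) = (i + j) * (n + 1)" using h(2) by (metis mult.left_commute)
  have "2 * ((i + j) * h) + (n - i) = j + n * (i + j + 1)"
    unfolding 2 using assms by (simp add: algebra_simps)
  with 1 show "(2 * ((i + j) * ((n + 1) div 2) mod n) + (n - i)) mod n = j"
    using assms(3) unfolding h(1) cong_def by (simp only: mod_mult_self2 mod_less)
  have "[(i + (2 * j + (n - i)) mod n) * h = (i + (2 * j + (n - i))) * h] (mod n)"
    by (intro cong_add cong_mult) (auto simp: cong_def)
  moreover have "(i + (2 * j + (n - i))) * h = j + n * (j + h)"
  proof -
    have "(i + (2 * j + (n - i))) * h = j * (2 * h) + n * h"
      using assms by (simp add: algebra_simps)
    then show ?thesis unfolding h(2) by (simp add: algebra_simps)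
  qed
  ultimately show "(i + (2 * j + (n - i)) mod n) * ((n + 1) div 2) mod n = j"
    using assms(3) unfolding h(1) cong_def by (simp only: mod_mult_self2 mod_less)
  \<comment> \<open>The inner residue is subtracted, so this identity is verified over the
    integers.\<close>
  have lt: "(2 * i + (n - j)) mod n < n" using assms by simp
  have "[int (2 * i + (n - (2 * i + (n - j)) mod n)) = int j] (mod int n)"
  proof -
    have "int ((2 * i + (n - j)) mod n) = (2 * int i + (int n - int j)) mod int n"
      using assms(3) by (simp add: zmod_int of_nat_diff add_diff_eq)
    then have "int (2 * i + (n - (2 * i + (n - j)) mod n)) = 2 * int i + int n - (2 * int i + (int n - int j)) mod int n"
      using lt by (simp only: of_nat_add of_nat_mult of_nat_diff less_imp_le of_nat_numeral)
    also have "[\<dots> = 2 * int i + int n - (2 * int i + (int n - int j))] (mod int n)"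
      by (intro cong_add cong_diff) (auto simp: cong_def)
    finally show ?thesis by simp
  qed
  then show "(2 * i + (n - (2 * i + (n - j)) mod n)) mod n = j"
    using assms(3) unfolding cong_int_iff by (simp only: cong_def mod_less)
qed

lemma bose_simps:
  assumes "k < 3" "l < 3"
  shows "bose n (3 * i + k) (3 * j + l) =
    (if i = j then 3 * i + (3 - k - l)
     else if k = l then 3 * ((i + j) * ((n + 1) div 2) mod n) + Suc k mod 3
     else if l = Suc k mod 3 then 3 * ((2 * j + (n - i)) mod n) + k
     else 3 * ((2 * i + (n - j)) mod n) + l)"
proof -
  have "(3 * i + k) div 3 = i" "(3 * i + k) mod 3 = k" "(3 * j + l) div 3 = j" "(3 * j + l) mod 3 = l"
    using assms by auto
  then show ?thesis unfolding bose_def Let_def by simp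
qed

text \<open>A block consists of the three points over one \<open>i\<close>, or of two points over
  \<open>i\<close> and \<open>j\<close> on one level \<open>k\<close> together with their midpoint
  on level \<open>k + 1\<close>. The branches of \<open>bose\<close> return whichever point is
  missing.\<close>

lemma bose_sts:
  assumes "odd n"
  shows "steiner_triple_system {..<3 * n}
    {{x, y, bose n x y} | x y. x \<in> {..<3 * n} \<and> y \<in> {..<3 * n} \<and> x \<noteq> y}"
proof (rule steiner_triple_system_of_third_point)
  have n: "n > 0" using assms by (cases n) auto
  have dec: "\<exists>i k. x = 3 * i + k \<and> k < 3 \<and> i < n" if "x \<in> {..<3 * n}" for x
    using that by (intro exI[of _ "x div 3"] exI[of _ "x mod 3"]) auto
  have less3: "k = 0 \<or> k = 1 \<or> k = 2" if "k < 3" for k :: nat using that by auto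
  have eq3: "3 * i + k = 3 * j + l \<longleftrightarrow> i = j \<and> k = l" if "k < 3" "l < 3" for i j k l :: nat
    using that by presburger
  fix x y assume xy: "x \<in> {..<3 * n}" "y \<in> {..<3 * n}" "x \<noteq> y"
  obtain i k where x: "x = 3 * i + k" "k < 3" "i < n" using dec xy by blast
  obtain j l where y: "y = 3 * j + l" "l < 3" "j < n" using dec xy by blast
  note half = half_sum_mod[OF assms x(3) y(3)] half_sum_mod[OF assms y(3) x(3)]
  \<comment> \<open>\<open>p\<close> is the midpoint of \<open>i\<close> and \<open>j\<close>,
    \<open>q\<close> the reflection of \<open>i\<close> in \<open>j\<close>, and \<open>r\<close>
    the reflection of \<open>j\<close> in \<open>i\<close>.\<close>
  define p where "p = (i + j) * ((n + 1) div 2) mod n"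
  define q where "q = (2 * j + (n - i)) mod n"
  define r where "r = (2 * i + (n - j)) mod n"
  have ne: "p \<noteq> i" "q \<noteq> i" "r \<noteq> j" if "i \<noteq> j"
  proof -
    show "p \<noteq> i"
    proof
      assume "p = i"
      with half(1) have "(2 * i + (n - i)) mod n = j" by (simp add: p_def)
      moreover have "2 * i + (n - i) = i + n" using x by simp
      ultimately show False using x that by simp
    qed
    show "q \<noteq> i"
    proof
      assume "q = i"
      with half(6) half(2) have "(2 * j + (n - i)) mod n = i" "(i + i) * ((n + 1) div 2) mod n = j" by (simp_all add: q_def)
      moreover have "(i + i) * ((n + 1) div 2) = i + n * i"
      proof -
        have "2 * ((n + 1) div 2) = n + 1" using assms by (metis dvd_mult_div_cancel even_plus_one_iff)
        then show ?thesis by (metis add.commute distrib_left mult.assoc mult.commute mult_2_right nat_mult_1_right)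
      qed
      ultimately show False using x that by simp
    qed
    show "r \<noteq> j"
    proof
      assume "r = j"
      with half(5) have "(j + j) * ((n + 1) div 2) mod n = i" by (simp add: r_def add.commute)
      moreover have "(j + j) * ((n + 1) div 2) = j + n * j"
      proof -
        have "2 * ((n + 1) div 2) = n + 1" using assms by (metis dvd_mult_div_cancel even_plus_one_iff)
        then show ?thesis by (metis add.commute distrib_left mult.assoc mult.commute mult_2_right nat_mult_1_right)
      qed
      ultimately show False using y that by simp
    qed
  qed
  have lt: "p < n" "q < n" "r < n" using n by (auto simp: p_def q_def r_def)
  have k3: "Suc k mod 3 < 3" "Suc k mod 3 \<noteq> k" using x(2) by presburger+
  have k3': "3 - k - l < 3" "3 - k - (3 - k - l) = l" "3 - k - l \<noteq> k" if "k \<noteq> l"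
    using that less3[OF x(2)] less3[OF y(2)] by auto
  have fxy: "bose n x y = (if i = j then 3 * i + (3 - k - l)
     else if k = l then 3 * p + Suc k mod 3 else if l = Suc k mod 3 then 3 * q + k else 3 * r + l)"
    using x y by (simp add: bose_simps p_def q_def r_def)
  show "bose n x y = bose n y x"
    unfolding x(1) y(1) bose_simps[OF x(2) y(2)] bose_simps[OF y(2) x(2)]
    using less3[OF x(2)] less3[OF y(2)]
    by (cases "i = j"; elim disjE; simp add: add.commute)
  show "bose n x y \<in> {..<3 * n} \<and> bose n x y \<noteq> x"
  proof (cases "i = j")
    case True
    then show ?thesis unfolding fxy using x y xy(3) less3[OF x(2)] less3[OF y(2)] by auto
  next
    case False
    have "3 * p + Suc k mod 3 < 3 * n" "3 * q + k < 3 * n" "3 * r + l < 3 * n"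
      using lt x(2) y(2) k3 by linarith+
    then show ?thesis unfolding fxy using ne[OF False] False k3 x y by (auto simp: eq3)
  qed
  show "bose n x (bose n x y) = y"
  proof (cases "i = j")
    case True
    then have kl: "k \<noteq> l" using x y xy(3) by auto
    have "bose n x (3 * i + (3 - k - l)) = 3 * i + (3 - k - (3 - k - l))"
      unfolding x(1) by (subst bose_simps) (use x(2) k3'[OF kl] in simp_all)
    then show ?thesis unfolding fxy using True y(1) k3'[OF kl] by simp
  next
    case False
    note ne = ne[OF False]
    \<comment> \<open>Replacing \<open>y\<close> by the third point exchanges the first two cases
      and preserves the last one, so each case uses one of the three identities of
      \<open>half_sum_mod\<close>.\<close>
    consider "k = l" | "k \<noteq> l" "l = Suc k mod 3" | "k \<noteq> l" "l \<noteq> Suc k mod 3" by blast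
    then show ?thesis
    proof cases
      case 1
      have "bose n x (3 * p + Suc k mod 3) = 3 * ((2 * p + (n - i)) mod n) + k"
        unfolding x(1) by (subst bose_simps) (use ne(1) k3 x(2) in simp_all)
      then show ?thesis using 1 False half(1) y(1) unfolding fxy p_def by simp
    next
      case 2
      have "bose n x (3 * q + k) = 3 * ((i + q) * ((n + 1) div 2) mod n) + Suc k mod 3"
        unfolding x(1) by (subst bose_simps) (use ne(2) x(2) in simp_all)
      then show ?thesis using 2 False half(2) y(1) unfolding fxy q_def by simp
    next
      case 3
      have "r \<noteq> i"
      proof
        assume "r = i"
        with half(3) have "(2 * i + (n - i)) mod n = j" by (simp add: r_def)
        moreover have "2 * i + (n - i) = i + n" using x by simp
        ultimately show False using x False by simp
      qed
      then have "bose n x (3 * r + l) = 3 * ((2 * i + (n - r)) mod n) + l"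
        unfolding x(1) by (subst bose_simps) (use 3 x(2) y(2) in simp_all)
      then show ?thesis using 3 False half(3) y(1) unfolding fxy r_def by simp
    qed
  qed
qed

text \<open>The marked block is the one formed by the three points over index 0.\<close>

lemma exists_sts_3_mod_6:
  fixes m :: nat
  assumes "m mod 6 = 3"
  shows "\<exists>S. steiner_triple_system {..<m} S \<and> {0, 1, 2} \<in> S"
proof -
  obtain n where n: "m = 3 * n" "odd n"
  proof
    show "m = 3 * (m div 3)" "odd (m div 3)" using assms by presburger+
  qed
  have "n > 0" using n(2) by (cases n) auto
  then have "0 \<in> {..<3 * n}" "1 \<in> {..<3 * n}" "{0, 1, 2} = {0, 1, bose n 0 1}"
    by (auto simp: bose_def)
  then have "{0, 1, 2} \<in> {{x, y, bose n x y} | x y. x \<in> {..<3 * n} \<and> y \<in> {..<3 * n} \<and> x \<noteq> y}"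
    by (intro CollectI exI[of _ "0::nat"] exI[of _ "1::nat"] conjI) simp_all
  then show ?thesis using bose_sts[OF n(2)] n(1) by blast
qed

text \<open>The cyclic system developed from the base blocks \<open>{0, 1, 4}\<close> and \<open>{0, 2, 7}\<close> modulo 13;
  the labels 2 and 4 are exchanged to turn the first one into \<open>{0, 1, 2}\<close>.\<close>
definition swap24 :: "nat \<Rightarrow> nat" where
  "swap24 x = (if x = 2 then 4 else if x = 4 then 2 else x)"

text \<open>Position \<open>e\<close> of the list gives the offset from \<open>x\<close> of the
  third point on the block through \<open>x\<close> and \<open>x + e\<close>.\<close>

definition cyclic13 :: "nat \<Rightarrow> nat \<Rightarrow> nat" where
  "cyclic13 x y = (x + [0, 4, 7, 12, 1, 11, 8, 2, 6, 10, 9, 5, 3] ! ((y + (13 - x)) mod 13)) mod 13"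

definition third13 :: "nat \<Rightarrow> nat \<Rightarrow> nat" where
  "third13 x y = swap24 (cyclic13 (swap24 x) (swap24 y))"

text \<open>This order serves \<open>w = 6\<close>. There order 3 modulo 6 would make part Z have 3
  vertices, too few for the exchange, or at least 9, and then some degree in Z exceeds the 6
  available colours.\<close>

lemma exists_sts_13:
  "\<exists>S. steiner_triple_system {..<13::nat} S \<and> {0, 1, 2} \<in> S"
proof -
  have chk: "\<forall>x\<in>set [0..<13]. \<forall>y\<in>set [0..<13]. x \<noteq> y \<longrightarrow>
      third13 x y < 13 \<and> third13 x y \<noteq> x \<and> third13 x y = third13 y x \<and> third13 x (third13 x y) = y"
    by code_simp
  have "steiner_triple_system {..<13} {{x, y, third13 x y} | x y. x \<in> {..<13} \<and> y \<in> {..<13} \<and> x \<noteq> y}"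
    by (rule steiner_triple_system_of_third_point) (use chk in \<open>auto simp: atLeast0LessThan\<close>)
  moreover have "{0::nat, 1, 2} \<in> {{x, y, third13 x y} | x y. x \<in> {..<13} \<and> y \<in> {..<13} \<and> x \<noteq> y}"
    by (intro CollectI exI[of _ 0] exI[of _ 1]) (simp add: third13_def swap24_def cyclic13_def)
  ultimately show ?thesis by blast
qed

section \<open>The partial triple system\<close>

lemma partial_stsI:
  assumes "finite U" and "\<And>T. T \<in> A \<Longrightarrow> T \<subseteq> U \<and> card T = 3"
    and "\<And>T T' x y. T \<in> A \<Longrightarrow> T' \<in> A \<Longrightarrow> x \<noteq> y \<Longrightarrow> x \<in> T \<Longrightarrow> y \<in> T \<Longrightarrow> x \<in> T' \<Longrightarrow> y \<in> T' \<Longrightarrow> T = T'"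
  shows "partial_sts U A"
  unfolding partial_sts_def
proof (intro conjI ballI impI)
  fix x y :: 'a assume "x \<noteq> y"
  have "finite {T \<in> A. {x, y} \<subseteq> T}"
    by (rule finite_subset[of _ "Pow U"]) (use assms(1,2) in auto)
  then show "card {T \<in> A. {x, y} \<subseteq> T} \<le> 1"
    using assms(3) \<open>x \<noteq> y\<close> by (auto simp: card_le_Suc0_iff_eq)
qed (use assms in auto)

definition cov :: "'a set set \<Rightarrow> 'a \<Rightarrow> 'a \<Rightarrow> bool" where
  "cov A x y \<longleftrightarrow> (\<exists>T\<in>A. x \<in> T \<and> y \<in> T)"

lemma cov_sym: "cov A x y \<longleftrightarrow> cov A y x"
  by (auto simp: cov_def)

lemma cov_Un: "cov (A \<union> B) x y \<longleftrightarrow> cov A x y \<or> cov B x y"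
  by (auto simp: cov_def)

lemma leave_eqI:
  assumes "\<And>e. e \<in> E \<Longrightarrow> \<exists>x\<in>U. \<exists>y\<in>U. x \<noteq> y \<and> e = {x, y}"
    and "\<And>x y. x \<in> U \<Longrightarrow> y \<in> U \<Longrightarrow> x \<noteq> y \<Longrightarrow> {x, y} \<in> E \<longleftrightarrow> \<not> cov A x y"
  shows "leave U A = E"
proof -
  have iff: "(\<not> (\<exists>T\<in>A. {x, y} \<subseteq> T)) \<longleftrightarrow> {x, y} \<in> E" if "x \<in> U" "y \<in> U" "x \<noteq> y" for x y
    using assms(2)[OF that] by (simp add: cov_def)
  show ?thesis
  proof (intro equalityI subsetI)
    fix e assume "e \<in> leave U A"
    then obtain x y where "x \<in> U" "y \<in> U" "x \<noteq> y" "\<not> (\<exists>T\<in>A. {x, y} \<subseteq> T)" "e = {x, y}"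
      unfolding leave_def by blast
    then show "e \<in> E" using iff[of x y] by simp
  next
    fix e assume e: "e \<in> E"
    then obtain x y where xy: "x \<in> U" "y \<in> U" "x \<noteq> y" "e = {x, y}" using assms(1) by blast
    then have "\<not> (\<exists>T\<in>A. {x, y} \<subseteq> T)" using iff[of x y] e by simp
    then show "e \<in> leave U A" unfolding leave_def using xy by blast
  qed
qed

lemma degree_eq_card_neighbours:
  assumes "\<And>e. e \<in> E \<Longrightarrow> card e = 2"
  shows "degree E v = card {u. {v, u} \<in> E}"
proof -
  have "bij_betw (\<lambda>u. {v, u}) {u. {v, u} \<in> E} {e \<in> E. v \<in> e}"
  proof (rule bij_betw_imageI)
    show "inj_on (\<lambda>u. {v, u}) {u. {v, u} \<in> E}"
      by (auto simp: inj_on_def doubleton_eq_iff)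
    show "(\<lambda>u. {v, u}) ` {u. {v, u} \<in> E} = {e \<in> E. v \<in> e}"
    proof (intro equalityI subsetI)
      fix e assume e: "e \<in> {e \<in> E. v \<in> e}"
      then obtain p q where "e = {p, q}" using assms[of e] by (auto simp: card_2_iff)
      then have "e = {v, p} \<or> e = {v, q}" using e by auto
      then show "e \<in> (\<lambda>u. {v, u}) ` {u. {v, u} \<in> E}" using e by auto
    qed auto
  qed
  then show ?thesis by (simp add: degree_def bij_betw_same_card)
qed

section \<open>The cyclic Latin square and the exchange of triples\<close>

lemma ex1_add_mod:
  fixes a c m :: nat
  assumes "a < m" "c < m"
  shows "\<exists>!b. b < m \<and> (a + b) mod m = c"
proof (rule ex1I[of _ "(c + (m - a)) mod m"])
  have "(a + (c + (m - a)) mod m) mod m = (a + (c + (m - a))) mod m" by (rule mod_add_right_eq)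
  also have "a + (c + (m - a)) = c + m" using assms by simp
  finally show "(c + (m - a)) mod m < m \<and> (a + (c + (m - a)) mod m) mod m = c"
    using assms by simp
next
  fix b assume b: "b < m \<and> (a + b) mod m = c"
  have "(c + (m - a)) mod m = ((a + b) + (m - a)) mod m"
    using b mod_add_left_eq[of "a + b" m "m - a"] by simp
  also have "(a + b) + (m - a) = b + m" using assms by simp
  finally show "b = (c + (m - a)) mod m" using b by simp
qed

text \<open>The parts are the residue classes modulo 3, and \<open>div 3\<close> recovers the index.
  Colours can thus be computed from an edge as a set, by summing \<open>v div 3\<close> over its
  ends.\<close>

definition vX :: "nat \<Rightarrow> nat" where "vX a = 3 * a"
definition vY :: "nat \<Rightarrow> nat" where "vY a = 3 * a + 1"
definition vZ :: "nat \<Rightarrow> nat" where "vZ a = 3 * a + 2"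

lemma v_eq [simp]:
  "vX a = vX b \<longleftrightarrow> a = b" "vY a = vY b \<longleftrightarrow> a = b" "vZ a = vZ b \<longleftrightarrow> a = b"
  "vX a \<noteq> vY b" "vY b \<noteq> vX a" "vX a \<noteq> vZ b" "vZ b \<noteq> vX a" "vY a \<noteq> vZ b" "vZ b \<noteq> vY a"
  unfolding vX_def vY_def vZ_def by presburger+

lemma v_div_3 [simp]: "vX a div 3 = a" "vY a div 3 = a" "vZ a div 3 = a"
  unfolding vX_def vY_def vZ_def by simp_all

lemma inj_v: "inj vX" "inj vY" "inj vZ"
  by (auto simp: inj_def)

text \<open>Here \<open>k\<close> is \<open>w - 2\<close>. Parts X and Y have vertices indexed by \<open>{..<m}\<close>, and only the indices
  \<open>{k + 2..<m}\<close> of part Z are used, so that the pairs \<open>a, b\<close> with \<open>(a + b) mod m < k + 2\<close> are left over.\<close>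

locale leave_construction =
  fixes m k :: nat and S :: "nat set set"
  assumes k: "even k" "k \<ge> 2" and m: "odd m" "k + 7 \<le> m"
    and S: "steiner_triple_system {..<m} S" and S012: "{0, 1, 2} \<in> S"
begin

definition tr :: "nat \<Rightarrow> nat \<Rightarrow> nat set" where
  "tr a b = {vX a, vY b, vZ ((a + b) mod m)}"

definition mixed :: "nat set set" where
  "mixed = {tr a b | a b. a < m \<and> b < m \<and> k + 2 \<le> (a + b) mod m}"

text \<open>The \<open>X\<close>-\<open>Y\<close> edges of the four mixed triples in \<open>removed\<close> form a 4-cycle. Each of its vertices
  gets a new triple with two points in part Z, which sets the four edges free. Three of them, three
  edges of the old leave and the edges of the removed triple \<open>{0, 1, 2}\<close> of part X make up the last
  three new triples. The net effect on the leave between X and Y is that the path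
  \<open>vX 1, vY k, vX 0, vY (k + 1)\<close> is replaced by the edge joining its ends.\<close>

definition removed :: "nat set set" where
  "removed = {vX ` {0, 1, 2}, tr 2 (k + 1), tr 1 (k + 1), tr 1 (k + 3), tr 2 (k + 3)}"

definition added :: "nat set set" where
  "added = {{vX 2, vZ (k + 3), vZ (k + 5)}, {vY (k + 1), vZ (k + 3), vZ (k + 2)},
    {vX 1, vZ (k + 2), vZ (k + 4)}, {vY (k + 3), vZ (k + 4), vZ (k + 5)},
    {vX 2, vX 1, vY (k + 3)}, {vX 1, vX 0, vY k}, {vX 2, vX 0, vY (k + 1)}}"

definition base :: "nat set set" where
  "base = (`) vX ` S \<union> (`) vY ` S \<union> mixed"

definition triples :: "nat set set" where
  "triples = (base - removed) \<union> added"

definition points :: "nat set" where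
  "points = vX ` {..<m} \<union> vY ` {..<m} \<union> vZ ` {k + 2..<m}"

lemma S_sub: "T \<in> S \<Longrightarrow> T \<subseteq> {..<m}" and S_card: "T \<in> S \<Longrightarrow> card T = 3"
  using S by (auto simp: steiner_triple_system_def)

lemma S_ex: "a < m \<Longrightarrow> b < m \<Longrightarrow> a \<noteq> b \<Longrightarrow> \<exists>T\<in>S. a \<in> T \<and> b \<in> T"
  using S unfolding steiner_triple_system_def by (metis insert_subset lessThan_iff)

lemma S_unique:
  assumes "T \<in> S" "T' \<in> S" "a \<in> T" "b \<in> T" "a \<in> T'" "b \<in> T'" "a \<noteq> b"
  shows "T = T'"
proof -
  have "a < m" "b < m" using assms S_sub by auto
  then have "\<exists>!T. T \<in> S \<and> {a, b} \<subseteq> T"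
    using S assms(7) by (auto simp: steiner_triple_system_def)
  then show ?thesis using assms by auto
qed

lemma tr_mem [simp]:
  "vX a \<in> tr a' b' \<longleftrightarrow> a = a'" "vY b \<in> tr a' b' \<longleftrightarrow> b = b'" "vZ c \<in> tr a' b' \<longleftrightarrow> c = (a' + b') mod m"
  by (auto simp: tr_def)

lemma tr_eq [simp]: "tr a b = tr a' b' \<longleftrightarrow> a = a' \<and> b = b'"
  by (metis tr_mem(1,2))

lemma X_img_mem [simp]:
  "vX a \<in> vX ` T \<longleftrightarrow> a \<in> T" "vY a \<in> vX ` T \<longleftrightarrow> False" "vZ a \<in> vX ` T \<longleftrightarrow> False"
  "vX a \<in> vY ` T \<longleftrightarrow> False" "vY a \<in> vY ` T \<longleftrightarrow> a \<in> T" "vZ a \<in> vY ` T \<longleftrightarrow> False"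
  "vX a \<in> vZ ` T \<longleftrightarrow> False" "vY a \<in> vZ ` T \<longleftrightarrow> False" "vZ a \<in> vZ ` T \<longleftrightarrow> a \<in> T"
  by auto

lemma v_points [simp]:
  "vX a \<in> points \<longleftrightarrow> a < m" "vY a \<in> points \<longleftrightarrow> a < m" "vZ a \<in> points \<longleftrightarrow> k + 2 \<le> a \<and> a < m"
  by (auto simp: points_def)

lemma points_cases:
  assumes "x \<in> points"
  obtains (X) a where "x = vX a" "a < m" | (Y) a where "x = vY a" "a < m"
    | (Z) a where "x = vZ a" "k + 2 \<le> a" "a < m"
  using assms by (auto simp: points_def)

lemma base_cases:
  assumes "T \<in> base"
  obtains (X) S' where "T = vX ` S'" "S' \<in> S" | (Y) S' where "T = vY ` S'" "S' \<in> S"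
    | (M) a b where "T = tr a b" "a < m" "b < m" "k + 2 \<le> (a + b) mod m"
  using assms by (auto simp: base_def mixed_def)

lemma base_points:
  assumes "T \<in> base"
  shows "T \<subseteq> points" "card T = 3"
proof -
  show "T \<subseteq> points" using assms
  proof (cases rule: base_cases)
    case (X S') then show ?thesis using S_sub[of S'] by auto
  next
    case (Y S') then show ?thesis using S_sub[of S'] by auto
  next
    case (M a b) then show ?thesis by (auto simp: tr_def)
  qed
  show "card T = 3" using assms
  proof (cases rule: base_cases)
    case (X S') then show ?thesis using S_card[of S'] by (simp add: card_image inj_on_def)
  next
    case (Y S') then show ?thesis using S_card[of S'] by (simp add: card_image inj_on_def)
  next
    case (M a b) then show ?thesis by (auto simp: tr_def)
  qed
qed

lemma add_mod_cancel:
  assumes "a < m" "b < m" "b' < m" "(a + b) mod m = (a + b') mod m"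
  shows "b = b'"
proof -
  have "\<exists>!b'. b' < m \<and> (a + b') mod m = (a + b) mod m"
    by (rule ex1_add_mod) (use assms(1) in auto)
  then show ?thesis using assms(2-4) by metis
qed

text \<open>Within X or Y this is the Steiner property. For mixed triples, any two of
  \<open>a\<close>, \<open>b\<close>, \<open>(a + b) mod m\<close> determine the third. Triples of
  different types share at most one point.\<close>

lemma base_unique:
  assumes T: "T \<in> base" "T' \<in> base" and xy: "x \<noteq> y" "x \<in> T" "y \<in> T" "x \<in> T'" "y \<in> T'"
  shows "T = T'"
  using T(1)
proof (cases rule: base_cases)
  case (X P)
  then obtain a b where ab: "x = vX a" "y = vX b" "a \<in> P" "b \<in> P" "a \<noteq> b" using xy by auto
  show ?thesis using T(2)
  proof (cases rule: base_cases)
    case X': (X P')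
    then have "P = P'" using S_unique[of P P' a b] X ab xy(4,5) by simp
    then show ?thesis using X X' by simp
  qed (use ab xy(4,5) in auto)
next
  case (Y P)
  then obtain a b where ab: "x = vY a" "y = vY b" "a \<in> P" "b \<in> P" "a \<noteq> b" using xy by auto
  show ?thesis using T(2)
  proof (cases rule: base_cases)
    case Y': (Y P')
    then have "P = P'" using S_unique[of P P' a b] Y ab xy(4,5) by simp
    then show ?thesis using Y Y' by simp
  qed (use ab xy(4,5) in auto)
next
  case (M a b)
  show ?thesis using T(2)
  proof (cases rule: base_cases)
    case (X P)
    then show ?thesis using xy M unfolding tr_def by auto
  next
    case (Y P)
    then show ?thesis using xy M unfolding tr_def by auto
  next
    case M': (M a' b')
    have "a = a' \<and> b = b' \<or> a = a' \<and> (a + b) mod m = (a' + b') mod m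
        \<or> b = b' \<and> (a + b) mod m = (a' + b') mod m"
      using xy unfolding M(1) M'(1) tr_def by (elim insertE emptyE) simp_all
    moreover have "b = b'" if "a = a'" "(a + b) mod m = (a' + b') mod m"
      using add_mod_cancel[of a b b'] that M M' by simp
    moreover have "a = a'" if "b = b'" "(a + b) mod m = (a' + b') mod m"
      using add_mod_cancel[of b a a'] that M M' by (simp add: add.commute)
    ultimately show ?thesis using M(1) M'(1) by blast
  qed
qed

section \<open>Pairs covered after the removal\<close>

lemma removed_base_mem:
  "vX ` S' \<in> removed \<longleftrightarrow> S' = {0, 1, 2}" "vY ` P \<notin> removed"
  "tr a b \<in> removed \<longleftrightarrow> (a = 1 \<or> a = 2) \<and> (b = k + 1 \<or> b = k + 3)"
proof -
  have 1: "vX ` A \<noteq> tr a b" "vY ` A \<noteq> tr a b" "vY ` A \<noteq> vX ` {0, 1, 2}" for A a b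
    by (metis X_img_mem tr_mem insertI1)+
  have 2: "vX ` A = vX ` B \<longleftrightarrow> A = B" for A B by (rule inj_image_eq_iff[OF inj_v(1)])
  show "vX ` S' \<in> removed \<longleftrightarrow> S' = {0, 1, 2}" "vY ` P \<notin> removed"
    "tr a b \<in> removed \<longleftrightarrow> (a = 1 \<or> a = 2) \<and> (b = k + 1 \<or> b = k + 3)"
    by (simp_all add: removed_def 1 1[symmetric] 2 del: image_insert One_nat_def) blast
qed

text \<open>By \<open>base_unique\<close> no other base triple covers the pair, so its fate is that
  of \<open>T\<close>. The coverage lemmas for XX, XZ and YZ pairs only have to find
  \<open>T\<close>.\<close>

lemma cov_base_iff:
  assumes "T \<in> base" "x \<in> T" "y \<in> T" "x \<noteq> y"
  shows "cov (base - removed) x y \<longleftrightarrow> T \<notin> removed"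
proof
  assume "cov (base - removed) x y"
  then obtain T' where "T' \<in> base" "T' \<notin> removed" "x \<in> T'" "y \<in> T'" by (auto simp: cov_def)
  then show "T \<notin> removed" using base_unique[of T T' x y] assms by simp
next
  assume "T \<notin> removed"
  then have "T \<in> base - removed" using assms(1) by simp
  then show "cov (base - removed) x y" unfolding cov_def using assms(2,3) by (intro bexI[of _ T] conjI)
qed

lemma cov_XX:
  assumes "a < m" "b < m" "a \<noteq> b"
  shows "cov (base - removed) (vX a) (vX b) \<longleftrightarrow> \<not> {a, b} \<subseteq> {0, 1, 2}"
proof -
  obtain P where P: "P \<in> S" "a \<in> P" "b \<in> P" using S_ex[OF assms] by blast
  have "vX ` P \<in> base" using P by (simp add: base_def)
  then have "cov (base - removed) (vX a) (vX b) \<longleftrightarrow> vX ` P \<notin> removed"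
    using P assms(3) by (intro cov_base_iff) simp_all
  also have "\<dots> \<longleftrightarrow> P \<noteq> {0, 1, 2}" using removed_base_mem by simp
  also have "\<dots> \<longleftrightarrow> \<not> {a, b} \<subseteq> {0, 1, 2}"
    using S_unique[OF P(1) S012 P(2,3)] P(2,3) assms(3) by blast
  finally show ?thesis .
qed

lemma cov_YY:
  assumes "a < m" "b < m" "a \<noteq> b"
  shows "cov (base - removed) (vY a) (vY b)"
proof -
  obtain P where P: "P \<in> S" "a \<in> P" "b \<in> P" using S_ex[OF assms] by blast
  then show ?thesis unfolding cov_def
    by (intro bexI[of _ "vY ` P"]) (auto simp: base_def removed_base_mem)
qed

lemma cov_ZZ:
  assumes "a \<noteq> b"
  shows "\<not> cov (base - removed) (vZ a) (vZ b)"
proof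
  assume "cov (base - removed) (vZ a) (vZ b)"
  then obtain T where T: "T \<in> base" "vZ a \<in> T" "vZ b \<in> T" by (auto simp: cov_def)
  from T(1) show False by (cases rule: base_cases) (use T(2,3) assms in auto)
qed

lemma cov_XY:
  assumes "a < m" "b < m"
  shows "cov (base - removed) (vX a) (vY b) \<longleftrightarrow>
    k + 2 \<le> (a + b) mod m \<and> \<not> ((a = 1 \<or> a = 2) \<and> (b = k + 1 \<or> b = k + 3))"
proof
  assume "cov (base - removed) (vX a) (vY b)"
  then obtain T where T: "T \<in> base" "T \<notin> removed" "vX a \<in> T" "vY b \<in> T" by (auto simp: cov_def)
  from T(1) show "k + 2 \<le> (a + b) mod m \<and> \<not> ((a = 1 \<or> a = 2) \<and> (b = k + 1 \<or> b = k + 3))"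
    by (cases rule: base_cases) (use T(2-4) removed_base_mem in auto)
next
  assume "k + 2 \<le> (a + b) mod m \<and> \<not> ((a = 1 \<or> a = 2) \<and> (b = k + 1 \<or> b = k + 3))"
  then show "cov (base - removed) (vX a) (vY b)" unfolding cov_def
    by (intro bexI[of _ "tr a b"]) (use assms in \<open>auto simp: base_def mixed_def removed_base_mem\<close>)
qed

lemma small_mod [simp]:
  "Suc (Suc k) mod m = k + 2" "Suc (Suc (Suc k)) mod m = k + 3" "Suc (Suc (Suc (Suc k))) mod m = k + 4"
  "Suc (Suc (Suc (Suc (Suc k)))) mod m = k + 5" "k mod m = k" "Suc k mod m = Suc k"
  "(k + 2) mod m = k + 2" "(k + 3) mod m = k + 3" "(k + 4) mod m = k + 4" "(k + 5) mod m = k + 5"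
  "(4 + k) mod m = k + 4" "(5 + k) mod m = k + 5"
  using m(2) by auto

lemma cov_XZ:
  assumes "a < m" "k + 2 \<le> c" "c < m"
  shows "cov (base - removed) (vX a) (vZ c) \<longleftrightarrow>
    \<not> (a = 2 \<and> (c = k + 3 \<or> c = k + 5) \<or> a = 1 \<and> (c = k + 2 \<or> c = k + 4))"
proof -
  \<comment> \<open>The triple covering the pair is found by solving \<open>a + b = c\<close> modulo
    \<open>m\<close>; it is in \<open>base\<close> because \<open>c\<close> is an index used in
    Z.\<close>
  obtain b where b: "b < m" "(a + b) mod m = c" using ex1_add_mod[of a m c] assms by blast
  have T: "tr a b \<in> base" using b assms by (auto simp: base_def mixed_def)
  have "cov (base - removed) (vX a) (vZ c) \<longleftrightarrow> tr a b \<notin> removed"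
    using T b(2) by (intro cov_base_iff) auto
  also have "\<dots> \<longleftrightarrow> \<not> (a = 2 \<and> (c = k + 3 \<or> c = k + 5) \<or> a = 1 \<and> (c = k + 2 \<or> c = k + 4))"
  proof -
    have *: "c = (a + b') mod m \<longleftrightarrow> b = b'" if "b' < m" for b'
      using add_mod_cancel[of a b b'] assms b that by auto
    show ?thesis unfolding removed_base_mem
      using *[of "k + 1"] *[of "k + 3"] m(2) by auto
  qed
  finally show ?thesis .
qed

lemma cov_YZ:
  assumes "b < m" "k + 2 \<le> c" "c < m"
  shows "cov (base - removed) (vY b) (vZ c) \<longleftrightarrow>
    \<not> (b = k + 1 \<and> (c = k + 2 \<or> c = k + 3) \<or> b = k + 3 \<and> (c = k + 4 \<or> c = k + 5))"
proof -
  obtain a where a: "a < m" "(a + b) mod m = c" using ex1_add_mod[of b m c] assms by (metis add.commute)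
  have T: "tr a b \<in> base" using a assms by (auto simp: base_def mixed_def)
  have "cov (base - removed) (vY b) (vZ c) \<longleftrightarrow> tr a b \<notin> removed"
    using T a(2) by (intro cov_base_iff) auto
  also have "\<dots> \<longleftrightarrow> \<not> (b = k + 1 \<and> (c = k + 2 \<or> c = k + 3) \<or> b = k + 3 \<and> (c = k + 4 \<or> c = k + 5))"
  proof -
    have *: "c = (a' + b) mod m \<longleftrightarrow> a = a'" if "a' < m" for a'
      using add_mod_cancel[of b a a'] assms a that by (auto simp: add.commute)
    show ?thesis unfolding removed_base_mem
      using *[of 1] *[of 2] m(2) by auto
  qed
  finally show ?thesis .
qed

lemmas cov_base = cov_XX cov_YY cov_ZZ cov_XY cov_XZ cov_YZ
  cov_sym[of _ "vY _" "vX _"] cov_sym[of _ "vZ _" "vX _"] cov_sym[of _ "vZ _" "vY _"]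

lemma small_less [simp]:
  "0 < m" "Suc 0 < m" "2 < m" "k < m" "Suc k < m" "Suc (Suc k) < m" "k + 2 < m" "k + 3 < m" "k + 4 < m" "k + 5 < m"
  using m(2) by auto

text \<open>Each pair in a new triple is either freed by the removal or uncovered from the start,
  being two points of Z or an X-Y pair with index sum \<open>k\<close> or
  \<open>k + 1\<close>.\<close>

lemma added_uncovered:
  assumes "T \<in> added" "x \<in> T" "y \<in> T" "x \<noteq> y"
  shows "\<not> cov (base - removed) x y"
proof -
  have "\<forall>T\<in>added. \<forall>x\<in>T. \<forall>y\<in>T. x \<noteq> y \<longrightarrow> \<not> cov (base - removed) x y"
    unfolding added_def by (simp add: cov_base)
  then show ?thesis using assms by blast
qed

lemma added_unique:
  assumes T: "T \<in> added" "T' \<in> added" and xy: "x \<noteq> y" "x \<in> T" "y \<in> T" "x \<in> T'" "y \<in> T'"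
  shows "T = T'"
proof -
  have "\<forall>T\<in>added. \<forall>T'\<in>added. \<forall>x\<in>T. \<forall>y\<in>T. x \<noteq> y \<longrightarrow> x \<in> T' \<longrightarrow> y \<in> T' \<longrightarrow> T = T'"
    unfolding added_def using k(2) by simp
  then show ?thesis using T xy by blast
qed

lemma partial_sts_triples: "partial_sts points triples"
proof (rule partial_stsI)
  show "finite points" by (simp add: points_def)
  show "T \<subseteq> points \<and> card T = 3" if "T \<in> triples" for T
    using that base_points[of T] m(2) unfolding triples_def added_def by auto
  fix T T' and x y :: nat
  assume T: "T \<in> triples" "T' \<in> triples" and xy: "x \<noteq> y" "x \<in> T" "y \<in> T" "x \<in> T'" "y \<in> T'"
  then show "T = T'"
    using base_unique[of T T' x y] added_unique[of T T' x y] added_uncovered[of T x y] added_uncovered[of T' x y]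
    unfolding triples_def cov_def by blast
qed

end

section \<open>The leave\<close>

lemma edge_colourable_Un:
  assumes "edge_colourable E n" "edge_colourable F n" "\<And>e f. e \<in> E \<Longrightarrow> f \<in> F \<Longrightarrow> e \<inter> f = {}"
  shows "edge_colourable (E \<union> F) n"
proof -
  obtain c where c: "\<forall>e\<in>E. c e < n" "\<forall>e\<in>E. \<forall>f\<in>E. e \<noteq> f \<and> e \<inter> f \<noteq> {} \<longrightarrow> c e \<noteq> c f"
    using assms(1) by (auto simp: edge_colourable_def)
  obtain d where d: "\<forall>e\<in>F. d e < n" "\<forall>e\<in>F. \<forall>f\<in>F. e \<noteq> f \<and> e \<inter> f \<noteq> {} \<longrightarrow> d e \<noteq> d f"
    using assms(2) by (auto simp: edge_colourable_def)
  have disj: "e \<inter> f = {}" "f \<inter> e = {}" if "e \<in> E" "f \<in> F" for e f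
    using assms(3)[OF that] by auto
  show ?thesis unfolding edge_colourable_def
  proof (intro exI[of _ "\<lambda>e. if e \<in> E then c e else d e"] conjI ballI impI)
    fix e f assume "e \<in> E \<union> F" "f \<in> E \<union> F" "e \<noteq> f \<and> e \<inter> f \<noteq> {}"
    then show "(if e \<in> E then c e else d e) \<noteq> (if f \<in> E then c f else d f)"
      using c(2) d(2) disj[of e f] disj[of f e] by (metis Un_iff)
  qed (use c(1) d(1) in auto)
qed

text \<open>Turns a colouring of ordered pairs, such as a matrix, into one of edges; symmetry makes
  the choice of an order of the ends harmless.\<close>

lemma edge_colourable_symmetricI:
  assumes E: "\<And>e. e \<in> E \<Longrightarrow> card e = 2"
    and sym: "\<And>a b. {a, b} \<in> E \<Longrightarrow> col a b = col b a"
    and less: "\<And>a b. {a, b} \<in> E \<Longrightarrow> col a b < n"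
    and proper: "\<And>a b c. {a, b} \<in> E \<Longrightarrow> {a, c} \<in> E \<Longrightarrow> b \<noteq> c \<Longrightarrow> col a b \<noteq> col a c"
  shows "edge_colourable E n"
proof -
  define c where "c e = (SOME z. \<exists>a b. e = {a, b} \<and> z = col a b)" for e
  have c: "c {a, b} = col a b" if "{a, b} \<in> E" for a b
    unfolding c_def
  proof (rule some_equality)
    show "\<exists>a' b'. {a, b} = {a', b'} \<and> col a b = col a' b'" by blast
    fix z assume "\<exists>a' b'. {a, b} = {a', b'} \<and> z = col a' b'"
    then show "z = col a b" using sym[OF that] by (metis doubleton_eq_iff)
  qed
  have pair: "\<exists>b. e = {a, b}" if "e \<in> E" "a \<in> e" for e a
    using E[OF that(1)] that(2) by (auto simp: card_2_iff)
  show ?thesis unfolding edge_colourable_def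
  proof (intro exI[of _ c] conjI ballI impI)
    fix e assume e: "e \<in> E"
    then obtain a b where "e = {a, b}" using E[OF e] by (auto simp: card_2_iff)
    then show "c e < n" using c less e by simp
  next
    fix e f assume ef: "e \<in> E" "f \<in> E" "e \<noteq> f \<and> e \<inter> f \<noteq> {}"
    then obtain a where "a \<in> e" "a \<in> f" by blast
    then obtain b d where bd: "e = {a, b}" "f = {a, d}" using pair ef(1,2) by metis
    then have "b \<noteq> d" using ef(3) by blast
    then show "c e \<noteq> c f" using proper c ef(1,2) unfolding bd by simp
  qed
qed

text \<open>The 4-cycle uncovered in the leave on Z, that is, the one absorbed by the new triples,
  with the indices of Z shifted to start at 0.\<close>

definition on_cycle :: "nat \<Rightarrow> nat \<Rightarrow> bool" where
  "on_cycle i j \<longleftrightarrow> (i = 0 \<or> i = 3) \<and> (j = 1 \<or> j = 2) \<or> (i = 1 \<or> i = 2) \<and> (j = 0 \<or> j = 3)"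

text \<open>The entries on the diagonal and on the removed 4-cycle are irrelevant.\<close>

definition colour_table :: "nat list list \<Rightarrow> nat \<Rightarrow> nat \<Rightarrow> bool" where
  "colour_table M n b \<longleftrightarrow> (\<forall>i\<in>set [0..<n]. \<forall>j\<in>set [0..<n]. M ! i ! j < b \<and> M ! i ! j = M ! j ! i \<and>
     (\<forall>l\<in>set [0..<n]. i \<noteq> j \<and> i \<noteq> l \<and> j \<noteq> l \<and> \<not> on_cycle i j \<and> \<not> on_cycle i l \<longrightarrow> M ! i ! j \<noteq> M ! i ! l))"

section \<open>Explicit form of the leave\<close>

context leave_construction
begin

text \<open>The gained edge from \<open>vX 1\<close> to \<open>vY (k + 1)\<close> has index sum
  \<open>k + 2\<close>, just outside the leftover range, hence its own disjunct. The negated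
  conditions take out the three edges of the lost path.\<close>

definition adj :: "nat \<Rightarrow> nat \<Rightarrow> bool" where
  "adj a b \<longleftrightarrow> a < m \<and> b < m \<and>
     (a = 1 \<and> b = k + 1 \<or>
      (a + b) mod m < k + 2 \<and> \<not> (a = 1 \<and> b = k) \<and> \<not> (a = 0 \<and> (b = k \<or> b = k + 1)))"

text \<open>The Z-Z pairs inside the first four triples of \<open>added\<close>, written as the
  complete bipartite graph between two pairs of indices.\<close>

definition cyc :: "nat \<Rightarrow> nat \<Rightarrow> bool" where
  "cyc c d \<longleftrightarrow> (c = k + 2 \<or> c = k + 5) \<and> (d = k + 3 \<or> d = k + 4)
    \<or> (c = k + 3 \<or> c = k + 4) \<and> (d = k + 2 \<or> d = k + 5)"

definition EXY :: "nat set set" where "EXY = {{vX a, vY b} | a b. adj a b}"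

definition cycle :: "nat set set" where
  "cycle = {{vZ (k + 2), vZ (k + 3)}, {vZ (k + 2), vZ (k + 4)},
    {vZ (k + 5), vZ (k + 3)}, {vZ (k + 5), vZ (k + 4)}}"

definition EZ :: "nat set set" where "EZ = {e. e \<subseteq> vZ ` {k + 2..<m} \<and> card e = 2} - cycle"

definition L :: "nat set set" where "L = EXY \<union> EZ"

lemma cov_added:
  "a \<noteq> b \<Longrightarrow> cov added (vX a) (vX b) \<longleftrightarrow> {a, b} \<subseteq> {0, 1, 2}"
  "cov added (vX a) (vY b) \<longleftrightarrow> (a = 1 \<or> a = 2) \<and> b = k + 3 \<or> (a = 0 \<or> a = 1) \<and> b = k \<or> (a = 0 \<or> a = 2) \<and> b = k + 1"
  "cov added (vX a) (vZ c) \<longleftrightarrow> (a = 2 \<and> (c = k + 3 \<or> c = k + 5) \<or> a = 1 \<and> (c = k + 2 \<or> c = k + 4))"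
  "cov added (vY b) (vZ c) \<longleftrightarrow> (b = k + 1 \<and> (c = k + 2 \<or> c = k + 3) \<or> b = k + 3 \<and> (c = k + 4 \<or> c = k + 5))"
  "c \<noteq> d \<Longrightarrow> cov added (vZ c) (vZ d) \<longleftrightarrow> cyc c d"
  unfolding cov_def added_def cyc_def by (simp_all; blast)+

lemma edge_mem:
  "{vX a, vX b} \<in> L \<longleftrightarrow> False"
  "{vY a, vY b} \<in> L \<longleftrightarrow> False"
  "{vX a, vY b} \<in> L \<longleftrightarrow> adj a b"
  "{vY b, vX a} \<in> L \<longleftrightarrow> adj a b"
  "{vX a, vZ c} \<in> L \<longleftrightarrow> False"
  "{vY a, vZ c} \<in> L \<longleftrightarrow> False"
  "{vZ c, vX a} \<in> L \<longleftrightarrow> False"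
  "{vZ c, vY a} \<in> L \<longleftrightarrow> False"
  "{vZ c, vZ d} \<in> L \<longleftrightarrow> k + 2 \<le> c \<and> c < m \<and> k + 2 \<le> d \<and> d < m \<and> c \<noteq> d \<and> \<not> cyc c d"
  by (auto simp: L_def EXY_def EZ_def cycle_def cyc_def doubleton_eq_iff card_insert_if)

lemma leave_triples: "leave points triples = L"
proof (rule leave_eqI)
  fix e assume "e \<in> L"
  then show "\<exists>x\<in>points. \<exists>y\<in>points. x \<noteq> y \<and> e = {x, y}"
    unfolding L_def
  proof
    assume "e \<in> EXY"
    then obtain a b where "e = {vX a, vY b}" "a < m" "b < m" by (auto simp: EXY_def adj_def)
    then show ?thesis by (intro bexI[of _ "vX a"] bexI[of _ "vY b"]) auto
  next
    assume "e \<in> EZ"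
    then obtain x y where "e = {x, y}" "x \<noteq> y" "x \<in> vZ ` {k + 2..<m}" "y \<in> vZ ` {k + 2..<m}"
      by (auto simp: EZ_def card_2_iff)
    then show ?thesis by (intro bexI[of _ x] bexI[of _ y]) (auto simp: points_def)
  qed
next
  fix x y assume xy: "x \<in> points" "y \<in> points" "x \<noteq> y"
  note simps = triples_def cov_Un cov_base cov_added edge_mem
    cov_sym[of added "vY _" "vX _"] cov_sym[of added "vZ _" "vX _"] cov_sym[of added "vZ _" "vY _"]
  have XY: "adj a b \<longleftrightarrow> \<not> cov (base - removed) (vX a) (vY b) \<and> \<not> cov added (vX a) (vY b)"
    if "a < m" "b < m" for a b
  proof -
    \<comment> \<open>All X-Y pairs affected by the exchange lie in this 3 by 3 block of indices;
      elsewhere only the index sum decides.\<close>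
    let ?special = "(a = 0 \<or> a = 1 \<or> a = 2) \<and> (b = k \<or> b = k + 1 \<or> b = k + 3)"
    show ?thesis
    proof (cases ?special)
      case True
      then show ?thesis unfolding cov_XY[OF that] cov_added adj_def by (elim conjE disjE) simp_all
    next
      case False
      then have "adj a b \<longleftrightarrow> (a + b) mod m < k + 2" "\<not> cov added (vX a) (vY b)"
        "cov (base - removed) (vX a) (vY b) \<longleftrightarrow> k + 2 \<le> (a + b) mod m"
        unfolding cov_XY[OF that] cov_added adj_def using that by blast+
      then show ?thesis by (simp add: not_le)
    qed
  qed
  from xy(1) show "{x, y} \<in> L \<longleftrightarrow> \<not> cov triples x y"
  proof (cases rule: points_cases)
    case X: (X a)
    from xy(2) show ?thesis
      by (cases rule: points_cases) (use X xy(3) XY in \<open>auto simp: simps\<close>)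
  next
    case Y: (Y b)
    from xy(2) show ?thesis
      by (cases rule: points_cases) (use Y xy(3) XY in \<open>auto simp: simps\<close>)
  next
    case Z: (Z c)
    from xy(2) show ?thesis
      by (cases rule: points_cases) (use Z xy(3) in \<open>auto simp: simps\<close>)
  qed
qed

lemma L_edge: "e \<in> L \<Longrightarrow> e \<subseteq> points \<and> card e = 2"
  unfolding leave_triples[symmetric] by (auto simp: leave_def)

lemma finite_points: "finite points"
  by (simp add: points_def)

lemma neighbour_points: "{u, v} \<in> L \<Longrightarrow> v \<in> points"
  using L_edge by blast

lemma adj_less: "adj a b \<Longrightarrow> a < m \<and> b < m"
  by (simp add: adj_def)

section \<open>Degrees in the leave\<close>

lemma finite_adj: "finite {b. adj a b}" "finite {a. adj a b}"
proof -
  have "{b. adj a b} \<subseteq> {..<m}" "{a. adj a b} \<subseteq> {..<m}" by (auto dest: adj_less)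
  then show "finite {b. adj a b}" "finite {a. adj a b}" using finite_subset by blast+
qed

lemma degree_L:
  "degree L (vX a) = card {b. adj a b}"
  "degree L (vY b) = card {a. adj a b}"
proof -
  have "{u. {vX a, u} \<in> L} = vY ` {b. adj a b}"
  proof (intro equalityI subsetI)
    fix u assume "u \<in> {u. {vX a, u} \<in> L}"
    then have u: "{vX a, u} \<in> L" by simp
    from neighbour_points[OF u] show "u \<in> vY ` {b. adj a b}"
      by (cases rule: points_cases) (use u in \<open>auto simp: edge_mem\<close>)
  qed (auto simp: edge_mem)
  then show "degree L (vX a) = card {b. adj a b}"
    using degree_eq_card_neighbours[of L] L_edge card_image[OF inj_on_subset[OF inj_v(2)]] by simp
  have "{u. {vY b, u} \<in> L} = vX ` {a. adj a b}"
  proof (intro equalityI subsetI)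
    fix u assume "u \<in> {u. {vY b, u} \<in> L}"
    then have u: "{vY b, u} \<in> L" by simp
    from neighbour_points[OF u] show "u \<in> vX ` {a. adj a b}"
      by (cases rule: points_cases) (use u in \<open>auto simp: edge_mem\<close>)
  qed (auto simp: edge_mem)
  then show "degree L (vY b) = card {a. adj a b}"
    using degree_eq_card_neighbours[of L] L_edge card_image[OF inj_on_subset[OF inj_v(1)]] by simp
qed

text \<open>The neighbourhood before the exchange. As addition is commutative, the same set serves
  for vertices of Y.\<close>

definition row :: "nat \<Rightarrow> nat set" where
  "row a = {b. b < m \<and> (a + b) mod m < k + 2}"

lemma finite_row: "finite (row a)"
  by (simp add: row_def)

lemma card_row:
  assumes "a < m"
  shows "card (row a) = k + 2"
proof -
  have "bij_betw (\<lambda>b. (a + b) mod m) (row a) {..<k + 2}"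
  proof (rule bij_betw_imageI)
    show "inj_on (\<lambda>b. (a + b) mod m) (row a)"
    proof (rule inj_onI)
      fix b b' assume "b \<in> row a" "b' \<in> row a" "(a + b) mod m = (a + b') mod m"
      then show "b = b'" using add_mod_cancel[OF assms, of b b'] unfolding row_def by blast
    qed
    show "(\<lambda>b. (a + b) mod m) ` row a = {..<k + 2}"
    proof (intro equalityI subsetI)
      fix c assume "c \<in> {..<k + 2}"
      then have c: "c < k + 2" "c < m" using m(2) by auto
      obtain b where b: "b < m" "(a + b) mod m = c" using ex1_add_mod[OF assms c(2)] by blast
      then have "b \<in> row a" using c(1) by (simp add: row_def)
      then show "c \<in> (\<lambda>b. (a + b) mod m) ` row a" using b(2) by blast
    next
      fix c assume "c \<in> (\<lambda>b. (a + b) mod m) ` row a"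
      then show "c \<in> {..<k + 2}" unfolding row_def by blast
    qed
  qed
  then show ?thesis by (simp add: bij_betw_same_card)
qed

text \<open>Only two rows change: \<open>vX 0\<close> loses \<open>k\<close> and
  \<open>k + 1\<close>, while \<open>vX 1\<close> trades \<open>k\<close> for \<open>k + 1\<close>.
  The columns \<open>k\<close> and \<open>k + 1\<close> behave in the same way.\<close>

lemma card_adj_row:
  assumes "a < m"
  shows "card {b. adj a b} + (if a = 0 then 2 else 0) = k + 2"
proof -
  consider "a = 0" | "a = 1" | "a \<noteq> 0" "a \<noteq> 1" by blast
  then show ?thesis
  proof cases
    case 1
    have "{b. adj a b} = row 0 - {k, k + 1}" using 1 by (auto simp: adj_def row_def)
    moreover have "{k, k + 1} \<subseteq> row 0" by (auto simp: row_def)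
    ultimately show ?thesis using 1 card_row[of 0] by (simp add: card_Diff_subset)
  next
    case 2
    have "{b. adj a b} = insert (k + 1) (row 1 - {k})" using 2 by (auto simp: adj_def row_def)
    moreover have "k \<in> row 1" "k + 1 \<notin> row 1" by (auto simp: row_def)
    ultimately show ?thesis using 2 card_row[of 1] finite_row[of 1] by (simp add: card_insert_if)
  next
    case 3
    have "{b. adj a b} = row a" using 3 assms by (auto simp: adj_def row_def)
    then show ?thesis using 3 card_row[OF assms] by simp
  qed
qed

lemma card_adj_col:
  assumes "b < m"
  shows "card {a. adj a b} + (if b = k then 2 else 0) = k + 2"
proof -
  consider "b = k" | "b = k + 1" | "b \<noteq> k" "b \<noteq> k + 1" by blast
  then show ?thesis
  proof cases
    case 1
    have "{a. adj a b} = row k - {0, 1}" using 1 by (auto simp: adj_def row_def add.commute)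
    moreover have "{0, 1} \<subseteq> row k" by (auto simp: row_def)
    ultimately show ?thesis using 1 card_row[of k] by (simp add: card_Diff_subset)
  next
    case 2
    have "{a. adj a b} = insert 1 (row (k + 1) - {0})" using 2 by (auto simp: adj_def row_def add.commute)
    moreover have "0 \<in> row (k + 1)" "1 \<notin> row (k + 1)" by (auto simp: row_def)
    ultimately show ?thesis using 2 card_row[of "k + 1"] finite_row[of "k + 1"] by (simp add: card_insert_if)
  next
    case 3
    have "{a. adj a b} = row b" using 3 assms by (auto simp: adj_def row_def add.commute)
    then show ?thesis using 3 card_row[OF assms] by simp
  qed
qed

text \<open>Part Z has an odd number of vertices, and each of them loses none or two of its
  neighbours to the 4-cycle.\<close>

lemma even_degree_Z:
  assumes c: "k + 2 \<le> c" "c < m"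
  shows "even (degree L (vZ c))"
proof -
  define D where "D = {d. cyc c d}"
  have D: "D = {} \<or> D = {k + 3, k + 4} \<or> D = {k + 2, k + 5}"
    by (auto simp: D_def cyc_def)
  then have cardD: "card D = 0 \<or> card D = 2" and fin: "finite D" and sub: "D \<subseteq> {k + 2..<m}"
    by auto
  have notin: "c \<notin> D" by (auto simp: D_def cyc_def)
  have "{u. {vZ c, u} \<in> L} = vZ ` ({k + 2..<m} - insert c D)"
  proof (intro equalityI subsetI)
    fix u assume "u \<in> {u. {vZ c, u} \<in> L}"
    then have u: "{vZ c, u} \<in> L" by simp
    from neighbour_points[OF u] show "u \<in> vZ ` ({k + 2..<m} - insert c D)"
      by (cases rule: points_cases) (use u in \<open>auto simp: edge_mem D_def\<close>)
  qed (use c in \<open>auto simp: edge_mem D_def\<close>)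
  then have "degree L (vZ c) = card ({k + 2..<m} - insert c D)"
    using degree_eq_card_neighbours[of L] L_edge card_image[OF inj_on_subset[OF inj_v(3)]] by simp
  also have "\<dots> = (m - (k + 2)) - Suc (card D)"
    using c fin sub notin by (subst card_Diff_subset) auto
  finally have deg: "degree L (vZ c) = (m - (k + 2)) - Suc (card D)" .
  show ?thesis unfolding deg using k(1) m cardD by auto
qed

lemma even_degree:
  assumes "v \<in> points"
  shows "even (degree L v)"
  using assms
proof (cases rule: points_cases)
  case (X a)
  have "even (card {b. adj a b} + (if a = 0 then 2 else 0))"
    using card_adj_row[OF X(2)] k(1) by simp
  then show ?thesis unfolding X(1) degree_L by (cases "a = 0") simp_all
next
  case (Y b)
  have "even (card {a. adj a b} + (if b = k then 2 else 0))"
    using card_adj_col[OF Y(2)] k(1) by simp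
  then show ?thesis unfolding Y(1) degree_L by (cases "b = k") simp_all
next
  case (Z c)
  then show ?thesis using even_degree_Z by simp
qed

section \<open>Counting edges and vertices\<close>

lemma card_EXY: "card EXY + 2 = m * (k + 2)"
proof -
  define e where "e = (\<lambda>(a, b). {vX a, vY b})"
  define P where "P = (SIGMA a:{..<m}. {b. adj a b})"
  have "EXY = e ` P"
  proof (intro equalityI subsetI)
    fix x assume "x \<in> EXY"
    then obtain a b where "x = e (a, b)" "adj a b" by (auto simp: EXY_def e_def)
    then show "x \<in> e ` P" using adj_less by (auto simp: P_def)
  qed (auto simp: EXY_def e_def P_def)
  moreover have "inj_on e P"
    by (rule inj_onI) (clarsimp simp: e_def doubleton_eq_iff)
  moreover have "card P = (\<Sum>a<m. card {b. adj a b})"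
    unfolding P_def using finite_adj by simp
  ultimately have "card EXY = (\<Sum>a<m. card {b. adj a b})"
    by (simp add: card_image)
  also have "\<dots> + 2 = (\<Sum>a<m. card {b. adj a b} + (if a = 0 then 2 else 0))"
    by (simp add: sum.distrib)
  also have "\<dots> = (\<Sum>a<m. k + 2)"
    by (rule sum.cong) (use card_adj_row in auto)
  finally show ?thesis by simp
qed

lemma card_EZ: "card EZ + 4 = (m - (k + 2)) choose 2"
proof -
  have "card {e. e \<subseteq> vZ ` {k + 2..<m} \<and> card e = 2} = card (vZ ` {k + 2..<m}) choose 2"
    by (rule n_subsets) simp
  also have "card (vZ ` {k + 2..<m}) = m - (k + 2)"
    by (subst card_image) (auto simp: inj_on_def)
  finally have 1: "card {e. e \<subseteq> vZ ` {k + 2..<m} \<and> card e = 2} = (m - (k + 2)) choose 2" .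
  have 2: "cycle \<subseteq> {e. e \<subseteq> vZ ` {k + 2..<m} \<and> card e = 2}"
    by (auto simp: cycle_def)
  have 3: "card cycle = 4" "finite cycle"
    by (simp_all add: cycle_def card_insert_if doubleton_eq_iff)
  have "finite {e. e \<subseteq> vZ ` {k + 2..<m} \<and> card e = 2}"
    by (rule finite_subset[of _ "Pow (vZ ` {k + 2..<m})"]) auto
  from card_mono[OF this 2] show ?thesis
    unfolding EZ_def using 1 2 3 by (simp add: card_Diff_subset)
qed

lemma EXY_EZ_disjoint: "e \<in> EXY \<Longrightarrow> f \<in> EZ \<Longrightarrow> e \<inter> f = {}"
  by (auto simp: EXY_def EZ_def)

lemma finite_EXY_EZ: "finite EXY" "finite EZ"
proof -
  have "finite L" by (rule finite_subset[of _ "Pow points"]) (use L_edge finite_points in auto)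
  then show "finite EXY" "finite EZ" by (auto simp: L_def)
qed

lemma card_L: "card L + 6 = m * (k + 2) + ((m - (k + 2)) choose 2)"
proof -
  have "EXY \<inter> EZ = {}" using EXY_EZ_disjoint by (auto simp: EXY_def)
  then have "card L = card EXY + card EZ"
    unfolding L_def using finite_EXY_EZ by (simp add: card_Un_disjoint)
  then show ?thesis using card_EXY card_EZ by simp
qed

lemma card_points: "card points = 2 * m + (m - (k + 2))"
proof -
  have "card (vX ` {..<m} \<union> vY ` {..<m}) = m + m"
    by (subst card_Un_disjoint) (auto simp: card_image inj_on_def)
  moreover have "card (vZ ` {k + 2..<m}) = m - (k + 2)"
    by (subst card_image) (auto simp: inj_on_def)
  ultimately show ?thesis
    unfolding points_def by (subst card_Un_disjoint) auto
qed

text \<open>Apart from the edge joining \<open>vX 1\<close> to \<open>vY (k + 1)\<close>, the sum of the indices is a proper colouring;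
  that edge takes the colour that its two ends lost.\<close>
lemma EXY_colourable: "edge_colourable EXY (k + 2)"
proof -
  define h where "h s = (if s mod m = k + 2 then k + 1 else s mod m)" for s :: nat
  have sum: "(\<Sum>v\<in>{vX a, vY b}. v div 3) = a + b" for a b by simp
  have adj_special: "a = 1 \<and> b = k + 1" if "adj a b" "(a + b) mod m = k + 2" for a b
    using that by (auto simp: adj_def)
  have row: "b = b'" if "adj a b" "adj a b'" "h (a + b) = h (a + b')" for a b b'
  proof -
    have lt: "a < m" "b < m" "b' < m" using that by (auto simp: adj_def)
    \<comment> \<open>Colour \<open>k + 1\<close> is free at \<open>vX 1\<close>: before the
      exchange it was on the edge to \<open>vY k\<close>, which is no longer in the leave.\<close>
    have *: False if "adj 1 c" "(1 + c) mod m = k + 1" for c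
    proof -
      have "c = k" using add_mod_cancel[of 1 c k] that by (auto simp: adj_def)
      then show False using that(1) by (simp add: adj_def)
    qed
    show ?thesis
      using that(3) adj_special[OF that(1)] adj_special[OF that(2)] *[of b] *[of b']
        that(1,2) add_mod_cancel[OF lt] unfolding h_def by (metis n_not_Suc_n)
  qed
  have col: "a = a'" if "adj a b" "adj a' b" "h (a + b) = h (a' + b)" for a a' b
  proof -
    have lt: "b < m" "a < m" "a' < m" using that by (auto simp: adj_def)
    \<comment> \<open>Colour \<open>k + 1\<close> is likewise free at \<open>vY (k + 1)\<close>,
      which lost its edge to \<open>vX 0\<close>.\<close>
    have *: False if "adj c (k + 1)" "(c + (k + 1)) mod m = k + 1" for c
    proof -
      have "c = 0" using add_mod_cancel[of "k + 1" c 0] that by (auto simp: adj_def add.commute)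
      then show False using that(1) by (simp add: adj_def)
    qed
    show ?thesis
      using that(3) adj_special[OF that(1)] adj_special[OF that(2)] *[of a] *[of a']
        that(1,2) add_mod_cancel[OF lt] unfolding h_def by (metis add.commute)
  qed
  show ?thesis unfolding edge_colourable_def
  proof (intro exI[of _ "\<lambda>e. h (\<Sum>v\<in>e. v div 3)"] conjI ballI impI)
    fix e assume "e \<in> EXY"
    then obtain a b where e: "e = {vX a, vY b}" "adj a b" by (auto simp: EXY_def)
    then show "h (\<Sum>v\<in>e. v div 3) < k + 2"
      unfolding e(1) sum by (auto simp: h_def adj_def)
  next
    fix e f assume ef: "e \<in> EXY" "f \<in> EXY" "e \<noteq> f \<and> e \<inter> f \<noteq> {}"
    obtain a b where e: "e = {vX a, vY b}" "adj a b" using ef by (auto simp: EXY_def)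
    obtain a' b' where f: "f = {vX a', vY b'}" "adj a' b'" using ef by (auto simp: EXY_def)
    have "a = a' \<and> b \<noteq> b' \<or> a \<noteq> a' \<and> b = b'" using ef(3) e f by auto
    then show "h (\<Sum>v\<in>e. v div 3) \<noteq> h (\<Sum>v\<in>f. v div 3)"
      unfolding e(1) f(1) sum using row col e(2) f(2) by blast
  qed
qed

section \<open>Colouring the edges within Z\<close>

lemma EZ_cases:
  assumes "e \<in> EZ"
  obtains c d where "e = {vZ c, vZ d}" "c < d" "k + 2 \<le> c" "d < m" "\<not> cyc c d"
proof -
  have "card e = 2" "e \<subseteq> vZ ` {k + 2..<m}" using assms by (auto simp: EZ_def)
  then obtain x y where xy: "e = {x, y}" "x \<noteq> y" "x \<in> vZ ` {k + 2..<m}" "y \<in> vZ ` {k + 2..<m}"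
    by (auto simp: card_2_iff)
  then obtain c d where cd: "e = {vZ c, vZ d}" "c \<noteq> d" by auto
  have "e \<in> L" using assms by (simp add: L_def)
  then have "k + 2 \<le> c" "c < m" "k + 2 \<le> d" "d < m" "\<not> cyc c d" "\<not> cyc d c"
    using edge_mem(9)[of c d] edge_mem(9)[of d c] unfolding cd(1) by (simp_all add: insert_commute)
  then show ?thesis using that[of c d] that[of d c] cd by (metis insert_commute linorder_neqE_nat)
qed

text \<open>Under the assumption Z has \<open>n \<le> k + 2\<close> vertices. Its indices are
  consecutive, hence distinct modulo \<open>n\<close>, so the index sum modulo \<open>n\<close>
  properly colours even the complete graph on Z.\<close>

lemma EZ_colourable:
  assumes "m \<le> 2 * (k + 2)"
  shows "edge_colourable EZ (k + 2)"
proof -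
  define n where "n = m - (k + 2)"
  have n: "0 < n" "n \<le> k + 2" using assms m(2) by (auto simp: n_def)
  have sum: "(\<Sum>v\<in>{vZ a, vZ b}. v div 3) = a + b" if "a \<noteq> b" for a b using that by simp
  have inj: "b = b'" if "(a + b) mod n = (a + b') mod n" "k + 2 \<le> b" "b < m" "k + 2 \<le> b'" "b' < m" for a b b'
  proof -
    have *: "b = b'" if "b \<le> b'" "(a + b) mod n = (a + b') mod n" "k + 2 \<le> b" "b' < m" for b b'
    proof -
      have "n dvd (a + b') - (a + b)" using that(2) by (metis mod_eq_dvd_iff_nat add_le_cancel_left that(1))
      then have "n dvd b' - b" by simp
      moreover have "b' - b < n" using that unfolding n_def by linarith
      ultimately show ?thesis using that(1) by (auto dest: dvd_imp_le)
    qed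
    show ?thesis using *[of b b'] *[of b' b] that by (metis nat_le_linear)
  qed
  show ?thesis unfolding edge_colourable_def
  proof (intro exI[of _ "\<lambda>e. (\<Sum>v\<in>e. v div 3) mod n"] conjI ballI impI)
    fix e assume "e \<in> EZ"
    show "(\<Sum>v\<in>e. v div 3) mod n < k + 2" using n by (meson less_le_trans mod_less_divisor)
  next
    fix e f assume ef: "e \<in> EZ" "f \<in> EZ" "e \<noteq> f \<and> e \<inter> f \<noteq> {}"
    obtain a b where e: "e = {vZ a, vZ b}" "a < b" "k + 2 \<le> a" "b < m" using ef(1) by (rule EZ_cases)
    obtain c d where f: "f = {vZ c, vZ d}" "c < d" "k + 2 \<le> c" "d < m" using ef(2) by (rule EZ_cases)
    have "a = c \<and> b \<noteq> d \<or> a = d \<and> b \<noteq> c \<or> b = c \<and> a \<noteq> d \<or> b = d \<and> a \<noteq> c"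
      using ef(3) e(1) f(1) by auto
    then have "(a + b) mod n \<noteq> (c + d) mod n"
      using inj[of a b d] inj[of a b c] inj[of b a d] inj[of b a c] e f by (auto simp: add.commute)
    then show "(\<Sum>v\<in>e. v div 3) mod n \<noteq> (\<Sum>v\<in>f. v div 3) mod n"
      unfolding e(1) f(1) using e(2) f(2) by (simp add: sum)
  qed
qed

lemma EZ_mem:
  assumes "{a, b} \<in> EZ"
  obtains i j where "a = vZ (k + 2 + i)" "b = vZ (k + 2 + j)" "i \<noteq> j"
    "k + 2 + i < m" "k + 2 + j < m" "\<not> on_cycle i j"
proof -
  have ab: "a \<in> vZ ` {k + 2..<m}" "b \<in> vZ ` {k + 2..<m}" using assms by (auto simp: EZ_def)
  then obtain c d where cd: "a = vZ c" "k + 2 \<le> c" "b = vZ d" "k + 2 \<le> d" by auto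
  define i j where "i = c - (k + 2)" "j = d - (k + 2)"
  then have ij: "a = vZ (k + 2 + i)" "b = vZ (k + 2 + j)" using cd by simp_all
  have "{a, b} \<in> L" using assms by (simp add: L_def)
  then have *: "k + 2 + i < m" "k + 2 + j < m" "i \<noteq> j" "\<not> cyc (k + 2 + i) (k + 2 + j)"
    unfolding ij edge_mem by simp_all
  have "\<not> on_cycle i j" using *(4) unfolding cyc_def on_cycle_def by auto
  then show ?thesis using that ij * by blast
qed

lemma EZ_colourable_table:
  assumes n: "m = k + 2 + n" and M: "colour_table M n (k + 2)"
  shows "edge_colourable EZ (k + 2)"
proof -
  let ?i = "\<lambda>v. v div 3 - (k + 2)"
  have i: "?i (vZ (k + 2 + i)) = i" for i by simp
  note M' = M[unfolded colour_table_def, rule_format]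
  show ?thesis
  proof (rule edge_colourable_symmetricI[where col = "\<lambda>x y. M ! ?i x ! ?i y"])
    show "card e = 2" if "e \<in> EZ" for e using that by (simp add: EZ_def)
    fix a b assume ab: "{a, b} \<in> EZ"
    obtain p q where p: "a = vZ (k + 2 + p)" "b = vZ (k + 2 + q)" "p \<noteq> q"
      "k + 2 + p < m" "k + 2 + q < m" "\<not> on_cycle p q" using ab by (rule EZ_mem)
    have pq: "p \<in> set [0..<n]" "q \<in> set [0..<n]" using p n by auto
    show "M ! ?i a ! ?i b = M ! ?i b ! ?i a" "M ! ?i a ! ?i b < k + 2"
      unfolding p(1,2) i using M'[OF pq] by blast+
    fix c assume ac: "{a, c} \<in> EZ" and bc: "b \<noteq> c"
    obtain p' r where r: "a = vZ (k + 2 + p')" "c = vZ (k + 2 + r)" "p' \<noteq> r"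
      "k + 2 + p' < m" "k + 2 + r < m" "\<not> on_cycle p' r" using ac by (rule EZ_mem)
    have "p' = p" using p(1) r(1) by simp
    moreover have "r \<in> set [0..<n]" "q \<noteq> r" using r p bc n by auto
    ultimately show "M ! ?i a ! ?i b \<noteq> M ! ?i a ! ?i c"
      unfolding p(1,2) r(2) i using M'[OF pq] p(3,6) r(3,6) by blast
  qed
qed

text \<open>Here \<open>w = 4\<close> and Z has 5 vertices, one more than there are colours. Without
  the 4-cycle only two triangles sharing a vertex remain, which 4 colours suffice for.\<close>

lemma EZ_colourable_4_5:
  assumes "k = 2" "m = 9"
  shows "edge_colourable EZ (k + 2)"
proof -
  have "colour_table [[0, 0, 0, 0, 1], [0, 0, 1, 0, 0], [0, 1, 0, 0, 3], [0, 0, 0, 0, 2], [1, 0, 3, 2, 0]] 5 4"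
    by code_simp
  then show ?thesis using assms by (intro EZ_colourable_table) simp_all
qed

text \<open>Here \<open>w = 6\<close> and Z has 7 vertices. The complete graph on them needs 7
  colours; dropping the 4-cycle leaves 17 edges, within the bound of 18 given by 6 matchings of 3
  edges.\<close>

lemma EZ_colourable_6_7:
  assumes "k = 4" "m = 13"
  shows "edge_colourable EZ (k + 2)"
proof -
  have "colour_table [[0, 0, 0, 0, 1, 2, 3], [0, 0, 3, 0, 4, 1, 2], [0, 3, 0, 0, 0, 5, 4], [0, 0, 0, 0, 2, 4, 1],
      [1, 4, 0, 2, 0, 3, 5], [2, 1, 5, 4, 3, 0, 0], [3, 2, 4, 1, 5, 0, 0]] 7 6"
    by code_simp
  then show ?thesis using assms by (intro EZ_colourable_table) simp_all
qed

section \<open>Verification of all conditions\<close>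

lemma L_no_decomposition:
  assumes "finite W" "card W = k + 2" "W \<inter> points = {}"
  shows "\<not> has_K3_decomposition (join_complete points L W)"
proof (rule no_K3_decomposition_join[where C = "vX ` {..<m} \<union> vY ` {..<m}" and x = "vX 0" and y = "vY k" and w = "k + 2"])
  have "card (vX ` {..<m} \<union> vY ` {..<m}) = m + m"
    by (subst card_Un_disjoint) (auto simp: card_image inj_on_def)
  then show "even (card (vX ` {..<m} \<union> vY ` {..<m}))" by simp
  show "e \<subseteq> vX ` {..<m} \<union> vY ` {..<m}" if "e \<in> L" "e \<inter> (vX ` {..<m} \<union> vY ` {..<m}) \<noteq> {}" for e
    using that by (auto simp: L_def EXY_def EZ_def adj_def)
  \<comment> \<open>The leave on X and Y is bipartite, hence triangle-free.\<close>
  show "{b, c} \<notin> L" if "a \<in> vX ` {..<m} \<union> vY ` {..<m}" "{a, b} \<in> L" "{a, c} \<in> L" for a b c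
  proof -
    have "b \<in> points" "c \<in> points" using that neighbour_points by blast+
    then show ?thesis using that by (auto simp: edge_mem elim!: points_cases)
  qed
  show "degree L (vX 0) + 2 = k + 2" using card_adj_row[of 0] degree_L(1)[of 0] by simp
  show "degree L (vY k) + 2 = k + 2" using card_adj_col[of k] degree_L(2)[of k] by simp
  show "degree L v = k + 2" if "v \<in> vX ` {..<m} \<union> vY ` {..<m}" "v \<noteq> vX 0" "v \<noteq> vY k" for v
    using that(1)
  proof
    assume "v \<in> vX ` {..<m}"
    then obtain a where "v = vX a" "a < m" by auto
    then show ?thesis using card_adj_row[of a] degree_L(1)[of a] that(2) by simp
  next
    assume "v \<in> vY ` {..<m}"
    then obtain a where "v = vY a" "a < m" by auto
    then show ?thesis using card_adj_col[of a] degree_L(2)[of a] that(3) by simp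
  qed
qed (use L_edge finite_points assms in \<open>auto simp: points_def\<close>)

text \<open>With the whole leave as \<open>G\<close>, \<open>slack\<close> is exactly condition (ii)
  after substituting the edge and vertex counts, and \<open>small\<close> lists the cases in which Z
  can be coloured.\<close>

lemma triples_counterexample:
  fixes w :: nat
  assumes w: "w = k + 2" and d: "m = w + d" and m6: "m mod 3 = 0 \<or> m mod 3 = 1"
    and small: "m \<le> 2 * w \<or> k = 2 \<and> m = 9 \<or> k = 4 \<and> m = 13"
    and slack: "int w ^ 2 - int d * int w - int w + int d ^ 2 - int d - 12 \<ge> 0"
  shows "\<exists>(U :: nat set) A.
    partial_sts U A \<and>
    (let L = leave U A; u = card U in
      (\<forall>x\<in>U. degree L x mod 2 = w mod 2) \<and>
      (w > 0 \<longrightarrow> odd (u + w)) \<and>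
      (card L + u * w + (w choose 2)) mod 3 = 0 \<and>
      (\<exists>G. G \<subseteq> L \<and> has_K3_decomposition (L - G) \<and>
           int w ^ 2 - (int u + 1) * int w + 2 * int (card G) \<ge> 0 \<and>
           edge_colourable G w) \<and>
      (\<forall>W :: nat set. finite W \<and> card W = w \<and> W \<inter> U = {} \<longrightarrow>
           \<not> has_K3_decomposition (join_complete U L W)))"
proof (intro exI[of _ points] exI[of _ triples] conjI)
  have u: "card points = 2 * m + d" using card_points w d by simp
  have cL: "card L + 6 = m * w + (d choose 2)" using card_L w d by simp
  have c2: "2 * (n choose 2) = n * (n - 1)" for n :: nat
  proof -
    have "even (n * (n - 1))" by (cases n) simp_all
    then show ?thesis by (simp only: choose_two dvd_mult_div_cancel)
  qed
  have two: "2 * int (n choose 2) = int n ^ 2 - int n" for n :: nat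
    using arg_cong[OF c2[of n], of int] by (cases n) (simp_all add: power2_eq_square algebra_simps)
  \<comment> \<open>Doubling removes the binomial coefficients and does not affect divisibility by
    3, which then depends only on \<open>m * (m - 1)\<close>.\<close>
  have sum: "2 * (int (card L) + int (card points) * int w + int (w choose 2))
      = int m ^ 2 - int m + 6 * (int m * int w) - 12"
  proof -
    have "int (card L) = int m * int w + int (d choose 2) - 6"
      using arg_cong[OF cL, of int] by simp
    then have "2 * (int (card L) + int (card points) * int w + int (w choose 2))
      = 2 * int m * int w + 2 * int (d choose 2) - 12 + 2 * (2 * int m + int d) * int w + 2 * int (w choose 2)"
      unfolding u by (simp add: algebra_simps)
    also have "\<dots> = int m ^ 2 - int m + 6 * (int m * int w) - 12"
      unfolding two d by (simp add: power2_eq_square algebra_simps)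
    finally show ?thesis .
  qed
  have "3 dvd int m ^ 2 - int m"
  proof -
    have "int m ^ 2 - int m = int m * (int m - 1)" by (simp add: power2_eq_square algebra_simps)
    moreover have "3 dvd int m \<or> 3 dvd int m - 1" using m6 by presburger
    ultimately show ?thesis by (metis dvd_mult dvd_mult2)
  qed
  then have "3 dvd 2 * (int (card L) + int (card points) * int w + int (w choose 2))"
    unfolding sum by presburger
  then have "3 dvd int (card L) + int (card points) * int w + int (w choose 2)"
    by presburger
  then have cond3: "(card L + card points * w + (w choose 2)) mod 3 = 0"
    by (metis of_nat_add of_nat_mult of_nat_dvd_iff of_nat_numeral mod_eq_0_iff_dvd)
  have cond2: "int w ^ 2 - (int (card points) + 1) * int w + 2 * int (card L) \<ge> 0"
  proof -
    have "2 * int (card L) = 2 * int m * int w + 2 * int (d choose 2) - 12"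
      using arg_cong[OF cL, of int] by simp
    then show ?thesis unfolding two u using slack d by (simp add: power2_eq_square algebra_simps)
  qed
  have col: "edge_colourable L w"
    unfolding L_def w
    by (rule edge_colourable_Un[OF EXY_colourable _ EXY_EZ_disjoint])
      (use small w EZ_colourable EZ_colourable_4_5 EZ_colourable_6_7 in auto)
  have emp: "has_K3_decomposition ({} :: nat set set)"
    unfolding has_K3_decomposition_def K3_decomposition_def by (intro exI[of _ "{}"]) simp
  show "partial_sts points triples" by (rule partial_sts_triples)
  have ev: "\<forall>x\<in>points. degree L x mod 2 = w mod 2"
    using even_degree k(1) w by (simp add: even_iff_mod_2_eq_zero)
  have od: "odd (card points + w)" unfolding u using m(1) d by simp
  show "let L = leave points triples; u = card points in
      (\<forall>x\<in>points. degree L x mod 2 = w mod 2) \<and>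
      (w > 0 \<longrightarrow> odd (u + w)) \<and>
      (card L + u * w + (w choose 2)) mod 3 = 0 \<and>
      (\<exists>G. G \<subseteq> L \<and> has_K3_decomposition (L - G) \<and>
           int w ^ 2 - (int u + 1) * int w + 2 * int (card G) \<ge> 0 \<and>
           edge_colourable G w) \<and>
      (\<forall>W :: nat set. finite W \<and> card W = w \<and> W \<inter> points = {} \<longrightarrow>
           \<not> has_K3_decomposition (join_complete points L W))"
    unfolding Let_def leave_triples
  proof (intro conjI impI exI[of _ L] allI)
    show "\<not> has_K3_decomposition (join_complete points L W)"
      if "finite W \<and> card W = w \<and> W \<inter> points = {}" for W
      using L_no_decomposition[of W] that w by blast
  qed (use ev od cond3 cond2 col emp in simp_all)
qed

end

section \<open>Choice of the part sizes for each \<open>w\<close>\<close>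

theorem theorem3:
  fixes w :: nat
  assumes "even w" and "w \<ge> 4"
  shows "\<exists>(U :: nat set) A.
    partial_sts U A \<and>
    (let L = leave U A; u = card U in
      (\<forall>x\<in>U. degree L x mod 2 = w mod 2) \<and>
      (w > 0 \<longrightarrow> odd (u + w)) \<and>
      (card L + u * w + (w choose 2)) mod 3 = 0 \<and>
      (\<exists>G. G \<subseteq> L \<and> has_K3_decomposition (L - G) \<and>
           int w ^ 2 - (int u + 1) * int w + 2 * int (card G) \<ge> 0 \<and>
           edge_colourable G w) \<and>
      (\<forall>W :: nat set. finite W \<and> card W = w \<and> W \<inter> U = {} \<longrightarrow>
           \<not> has_K3_decomposition (join_complete U L W)))"
proof -
  define k where "k = w - 2"
  have wk: "w = k + 2" "even k" "k \<ge> 2" using assms by (auto simp: k_def)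
  \<comment> \<open>\<open>d\<close> is the size of part Z and \<open>w + d\<close> that of parts X and Y, which must carry a Steiner triple system.\<close>
  have "\<exists>d. odd d \<and> 5 \<le> d \<and> (d \<le> w \<or> w = 4 \<and> d = 5 \<or> w = 6 \<and> d = 7) \<and> ((w + d) mod 6 = 3 \<or> w + d = 13)
      \<and> (d = 5 \<or> d = 7 \<or> d = 9)"
  proof -
    obtain h where h: "w = 2 * h" using assms(1) by blast
    have "h mod 3 = 0 \<or> h mod 3 = 1 \<or> h mod 3 = 2" by presburger
    moreover have "h = 3 * (h div 3) + h mod 3" by simp
    ultimately obtain q where "h = 3 * q \<or> h = 3 * q + 1 \<or> h = 3 * q + 2"
      by (metis add_0_right)
    then have "w = 6 * q \<or> w = 6 * q + 2 \<or> w = 6 * q + 4" using h by auto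
    moreover have "q = 0 \<or> q = 1 \<or> q \<ge> 2" by auto
    ultimately have "w = 6 \<or> w = 6 * q + 4 \<or> w = 6 * q + 2 \<and> q \<ge> 1 \<or> w = 6 * q \<and> q \<ge> 2"
      using assms(2) by auto
    \<comment> \<open>The residue of \<open>w\<close> modulo 6 dictates \<open>d\<close>: 5, 7 or 9
      for residues 4, 2 or 0, making \<open>w + d\<close> equal to 3 modulo 6. The exception
      \<open>w = 6\<close> takes \<open>d = 7\<close> and order 13.\<close>
    then consider "w = 6" | "w = 6 * q + 4" | "w = 6 * q + 2" "q \<ge> 1" | "w = 6 * q" "q \<ge> 2"
      by blast
    then show ?thesis
    proof cases
      case 1
      then show ?thesis by (intro exI[of _ 7]) simp
    next
      case 2
      then have "(w + 5) mod 6 = 3" by presburger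
      then show ?thesis using 2 by (intro exI[of _ 5]) auto
    next
      case 3
      then have "(w + 7) mod 6 = 3" by presburger
      then show ?thesis using 3 by (intro exI[of _ 7]) auto
    next
      case 4
      then have "(w + 9) mod 6 = 3" by presburger
      then show ?thesis using 4 by (intro exI[of _ 9]) auto
    qed
  qed
  then obtain d where d: "odd d" "5 \<le> d" "d \<le> w \<or> w = 4 \<and> d = 5 \<or> w = 6 \<and> d = 7"
    "(w + d) mod 6 = 3 \<or> w + d = 13" "d = 5 \<or> d = 7 \<or> d = 9" by blast
  define m where "m = w + d"
  obtain S where S: "steiner_triple_system {..<m} S" "{0, 1, 2} \<in> S"
    using d(4) exists_sts_3_mod_6[of m] exists_sts_13 unfolding m_def by metis
  interpret leave_construction m k S
    by unfold_locales (use wk d m_def S in auto)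
  have m3: "m mod 3 = 0 \<or> m mod 3 = 1" using d(4) unfolding m_def by presburger
  have slack: "int w ^ 2 - int d * int w - int w + int d ^ 2 - int d - 12 \<ge> 0"
  proof -
    \<comment> \<open>For \<open>d = 5\<close> the expression is \<open>(w - 2) * (w - 4)\<close>,
      zero at \<open>w = 4\<close>. For \<open>d = 7\<close> and \<open>d = 9\<close> it is
      \<open>(w - 4)^2 + 14\<close> and \<open>(w - 5)^2 + 35\<close>.\<close>
    have "0 \<le> (int w - 2) * (int w - 4)" using assms(2) by simp
    then have 5: "int w ^ 2 - 6 * int w + 8 \<ge> 0" by (simp add: power2_eq_square algebra_simps)
    have "0 \<le> (int w - 4) ^ 2" "0 \<le> (int w - 5) ^ 2" by simp_all
    then have "int w ^ 2 - 8 * int w + 30 \<ge> 0" "int w ^ 2 - 10 * int w + 60 \<ge> 0"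
      by (simp_all add: power2_eq_square algebra_simps)
    with 5 show ?thesis using d(5) by auto
  qed
  show ?thesis
    by (rule triples_counterexample[OF wk(1) m_def m3 _ slack]) (use d(3) wk(1) in \<open>auto simp: m_def\<close>)
qed

end
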